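(* There exist positive constants $C_1',C_2',K_1',K_2',K_3'$ such that the following holds. For all parameters $b,\mu$ (with $\mu>0$) and every $k\in\mathbb Z$ satisfying $$|k\mu|+1\le C_1'\sqrt{b\mu},\qquad b\ge C_2'\mu,$$ the boundaries $a_{0,k}(b)$, $a_{\pi,k}(b)$ of the $k$-th Arnold tongue (for this value of $\mu$) of the equation $\dfrac{dx}{dt}=\dfrac{\cos x+a+b\cos t}{\mu}$ satisfy $$\left|\frac{a_{0,k}(b)}{\mu}-k+\frac1\mu J_k\left(-\frac b\mu\right)\right|\le\frac1b\left(K_1'+\frac{K_2'}{\mu^3}+K_3'\ln\left(\frac b\mu\right)\right),$$ $$\left|\frac{a_{\pi,k}(b)}{\mu}-k-\frac1\mu J_k\left(-\frac b\mu\right)\right|\le\frac1b\left(K_1'+\frac{K_2'}{\mu^3}+K_3'\ln\left(\frac b\mu\right)\right).$$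
   Context: For $a,b\in\mathbb R$, $\mu>0$ consider the Josephson equation $\frac{dx}{dt}=\frac{\cos x+a+b\cos t}{\mu}$, with $x$ real-valued. Let $\widetilde P_{a,b,\mu}:\mathbb R\to\mathbb R$ be the time-$2\pi$ map, $\widetilde P_{a,b,\mu}(x_0)=x(2\pi)$ for the solution with $x(0)=x_0$; it is a lift of the Poincaré map $P_{a,b,\mu}$ of $\mathbb R/2\pi\mathbb Z$. The rotation number is $\rho_{a,b,\mu}=\lim_{n\to\infty}\frac{\widetilde P_{a,b,\mu}^{\circ n}(x)-x}{2\pi n}$ (independent of $x$). For $k\in\mathbb Z$ the $k$-th Arnold tongue is $E_k=\{(a,b,\mu):\rho_{a,b,\mu}=k\}$. For fixed $\mu>0$ and $b>0$, the set $\{a\in\mathbb R:(a,b,\mu)\in E_k\}$ is a closed interval (possibly a single point) whose two endpoints are denoted $a_{0,k}(b)$ and $a_{\pi,k}(b)$ (dependence on $\mu$ is suppressed), where $0$ (respectively $\pi$) is a fixed point of $P_{a,b,\mu}$ when $a=a_{0,k}(b)$ (respectively $a=a_{\pi,k}(b)$). Equivalently, $a_{0,k}(b)$ is the unique $a$ for which the solution with $x(0)=0$ satisfies $x(2\pi)=2\pi k$, and $a_{\pi,k}(b)$ is the unique $a$ for which the solution with $x(0)=\pi$ satisfies $x(2\pi)=\pi+2\pi k$. $J_k$ is the Bessel function of the first kind: $J_k(-z)=\frac1{2\pi}\int_0^{2\pi}\cos(kt+z\sin t)\,dt$. The constants are absolute (independent of $b,\mu,k$). *)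

theory Defs
  imports "HOL-Analysis.Analysis"
begin

definition josephson_solution :: "real \<Rightarrow> real \<Rightarrow> real \<Rightarrow> (real \<Rightarrow> real) \<Rightarrow> bool" where
  "josephson_solution a b \<mu> x \<longleftrightarrow>
     (\<forall>t. (x has_real_derivative ((cos (x t) + a + b * cos t) / \<mu>)) (at t))"

text \<open>The right-hand side is bounded and Lipschitz in \<open>x\<close>, so for \<open>\<mu> > 0\<close> every initial value
  problem has exactly one solution on the whole real line, and the definite description below
  is meaningful.\<close>

definition poincare_lift :: "real \<Rightarrow> real \<Rightarrow> real \<Rightarrow> real \<Rightarrow> real" where
  "poincare_lift a b \<mu> x0 =
     (THE y. \<exists>x. josephson_solution a b \<mu> x \<and> x 0 = x0 \<and> x (2 * pi) = y)"

text \<open>The class of \<open>\<theta>\<close> modulo \<open>2 * pi\<close> is fixed by the circle map induced by the lift.\<close>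

definition poincare_fixes :: "real \<Rightarrow> real \<Rightarrow> real \<Rightarrow> real \<Rightarrow> bool" where
  "poincare_fixes a b \<mu> \<theta> \<longleftrightarrow>
     (\<exists>m::int. poincare_lift a b \<mu> \<theta> = \<theta> + 2 * pi * of_int m)"

text \<open>Relational form of the rotation number: the limit exists and equals \<open>\<rho>\<close> for every starting
  point. At most one \<open>\<rho>\<close> satisfies this.\<close>

definition has_rotation_number :: "real \<Rightarrow> real \<Rightarrow> real \<Rightarrow> real \<Rightarrow> bool" where
  "has_rotation_number a b \<mu> \<rho> \<longleftrightarrow>
     (\<forall>x. (\<lambda>n. ((poincare_lift a b \<mu> ^^ n) x - x) / (2 * pi * real n)) \<longlonglongrightarrow> \<rho>)"

definition arnold_tongue :: "int \<Rightarrow> (real \<times> real \<times> real) set" where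
  "arnold_tongue k = {(a, b, \<mu>). \<mu> > 0 \<and> has_rotation_number a b \<mu> (of_int k)}"

text \<open>The section of a tongue at fixed \<open>b\<close> and \<open>\<mu>\<close> is a compact interval, possibly a single point.
  Real segments are unordered, so \<open>a\<close> below may be either endpoint. No order between the two
  boundaries is presupposed: they are told apart by the point (\<open>0\<close> or \<open>pi\<close>) that is fixed.\<close>

definition tongue_endpoint :: "real \<Rightarrow> real \<Rightarrow> int \<Rightarrow> real \<Rightarrow> bool" where
  "tongue_endpoint b \<mu> k a \<longleftrightarrow>
     (\<exists>c. {a'. (a', b, \<mu>) \<in> arnold_tongue k} = closed_segment a c)"

definition tongue_boundary :: "real \<Rightarrow> real \<Rightarrow> real \<Rightarrow> int \<Rightarrow> real" where
  "tongue_boundary \<theta> b \<mu> k = (THE a. tongue_endpoint b \<mu> k a \<and> poincare_fixes a b \<mu> \<theta>)"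

abbreviation tongue_boundary_0 :: "real \<Rightarrow> real \<Rightarrow> int \<Rightarrow> real" where
  "tongue_boundary_0 \<equiv> tongue_boundary 0"

abbreviation tongue_boundary_pi :: "real \<Rightarrow> real \<Rightarrow> int \<Rightarrow> real" where
  "tongue_boundary_pi \<equiv> tongue_boundary pi"

text \<open>Bessel's integral for the Bessel function of the first kind of integer order.\<close>

definition bessel_J :: "int \<Rightarrow> real \<Rightarrow> real" where
  "bessel_J k w = 1 / (2 * pi) * integral {0..2 * pi} (\<lambda>t. cos (of_int k * t - w * sin t))"

end

(*
  Put x = phi + y with phi = theta + k t + beta sin t, omega = 1/mu, beta = b/mu.  Then y' = omega cos x + delta
  with delta = a/mu - k, and on the boundary y vanishes at 0 and at 2 pi, so 2 pi delta is
  -omega times the integral of cos x; replacing x by phi gives the Bessel term.  With g = phi' and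
  the regularised reciprocal h = g/(g^2+beta) one integrates by parts: once to see that
  y = O(omega (1+omega)/sqrt beta), and a second time to see that the integrals of cos x and cos phi
  differ by O(omega (1+omega)/beta).  The dangerous term, omega times the integral of h, is small
  because h is nearly odd under t -> t + pi; no logarithm survives.

  That the boundary points are the parameters a for which 0 or pi is fixed: by time reversal the
  fixed points come in pairs x, -x, and the period map is a Moebius map, so three fixed points force
  the identity.  By the intermediate value theorem in x, a parameter of the tongue outside the segment
  spanned by the two special parameters would give a map with four fixed points that is not the
  identity.
*)
theory Submission
  imports Defs
begin

section \<open>Global solutions of scalar equations\<close>

lemma real_antiderivative:
  fixes g :: "real \<Rightarrow> real"
  assumes "continuous_on UNIV g"
  obtains G where "\<And>t. (G has_real_derivative g t) (at t)" "G 0 = 0"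
proof -
  have "\<exists>F. \<forall>x :: real. (- \<infinity> :: ereal) < x \<longrightarrow> x < (\<infinity> :: ereal) \<longrightarrow> (F has_vector_derivative g x) (at x)"
    by (rule einterval_antiderivative)
      (use assms in \<open>auto simp: continuous_on_eq_continuous_at\<close>)
  then obtain F where F: "(F has_real_derivative g t) (at t)" for t
    by (auto simp: has_real_derivative_iff_has_vector_derivative)
  show ?thesis
    by (rule that[of "\<lambda>t. F t - F 0"]) (auto intro!: derivative_eq_intros F)
qed

lemma exp_growth_nonneg:
  fixes G :: "real \<Rightarrow> real"
  assumes d: "\<And>t. (G has_real_derivative g t) (at t)" and "G 0 = 0" "L > 0" "0 \<le> t" "0 \<le> c"
    and b: "\<And>t. 0 \<le> t \<Longrightarrow> \<bar>g t\<bar> \<le> c * exp (L * t)"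
  shows "\<bar>G t\<bar> \<le> c / L * exp (L * t)"
proof -
  have upper: "H t \<le> c / L * exp (L * t)"
    if dH: "\<And>t. (H has_real_derivative h t) (at t)" and "H 0 = 0"
      and bH: "\<And>t. 0 \<le> t \<Longrightarrow> h t \<le> c * exp (L * t)" for H h
  proof -
    have "c / L * exp (L * 0) - H 0 \<le> c / L * exp (L * t) - H t"
    proof (rule DERIV_nonneg_imp_nondecreasing[OF \<open>0 \<le> t\<close>])
      fix s assume "0 \<le> s" "s \<le> t"
      have "((\<lambda>t. c / L * exp (L * t) - H t) has_real_derivative c * exp (L * s) - h s) (at s)"
        using \<open>L > 0\<close> by (auto intro!: derivative_eq_intros dH)
      then show "\<exists>y. ((\<lambda>t. c / L * exp (L * t) - H t) has_real_derivative y) (at s) \<and> 0 \<le> y"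
        using bH[OF \<open>0 \<le> s\<close>] by auto
    qed
    moreover have "0 \<le> c / L" using assms by simp
    ultimately show ?thesis using \<open>H 0 = 0\<close> by simp
  qed
  have "G t \<le> c / L * exp (L * t)"
    by (rule upper[OF d]) (use assms b in \<open>auto intro: order_trans[OF abs_ge_self]\<close>)
  moreover have "- G t \<le> c / L * exp (L * t)"
    by (rule upper[where H="\<lambda>t. - G t" and h="\<lambda>t. - g t"])
      (use assms b in \<open>auto intro!: derivative_intros d intro: order_trans[OF abs_ge_minus_self]\<close>)
  ultimately show ?thesis by simp
qed

lemma exp_growth:
  fixes G :: "real \<Rightarrow> real"
  assumes d: "\<And>t. (G has_real_derivative g t) (at t)" and "G 0 = 0" "L > 0" "0 \<le> c"
    and b: "\<And>t. \<bar>g t\<bar> \<le> c * exp (L * \<bar>t\<bar>)"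
  shows "\<bar>G t\<bar> \<le> c / L * exp (L * \<bar>t\<bar>)"
proof (cases "0 \<le> t")
  case True
  show ?thesis
    using exp_growth_nonneg[OF d \<open>G 0 = 0\<close> \<open>L > 0\<close> True \<open>0 \<le> c\<close>] b True
    by (metis abs_of_nonneg)
next
  case False
  have d': "((\<lambda>s. G (- s)) has_real_derivative - g (- s)) (at s)" for s
    using DERIV_mirror[of G "g (- s)" s] d[of "- s"] by simp
  have b': "\<bar>- g (- s)\<bar> \<le> c * exp (L * s)" if "0 \<le> s" for s
    using b[of "- s"] that by simp
  show ?thesis
    using exp_growth_nonneg[OF d' _ \<open>L > 0\<close> _ \<open>0 \<le> c\<close> b', of "- t"] False \<open>G 0 = 0\<close>
    by simp
qed

theorem ode_exists:
  fixes F :: "real \<Rightarrow> real \<Rightarrow> real"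
  assumes cont: "continuous_on UNIV (\<lambda>(t, x). F t x)"
    and bound: "\<And>t x. \<bar>F t x\<bar> \<le> B"
    and lip: "\<And>t x y. \<bar>F t x - F t y\<bar> \<le> L * \<bar>x - y\<bar>"
    and "L > 0"
  obtains x where "x 0 = x0" "\<And>t. (x has_real_derivative F t (x t)) (at t)"
proof -
  have "0 \<le> B" using bound[of 0 0] by linarith
  define w where "w t = exp (2 * L * \<bar>t\<bar>)" for t :: real
  have w_pos: "w t > 0" for t by (simp add: w_def)
  have w_cont: "continuous_on UNIV w" unfolding w_def by (intro continuous_intros)
  have contF: "continuous_on UNIV (\<lambda>t. F t (f t))" if "continuous_on UNIV f" for f
    using continuous_on_compose2[OF cont continuous_on_Pair[OF continuous_on_id that]] by simp
  define rhs where "rhs u t = F t (x0 + w t * apply_bcontfun u t)" for u t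
  have rhs_cont: "continuous_on UNIV (rhs u)" for u
    unfolding rhs_def by (intro contF continuous_intros w_cont) auto
  define I where "I u = (SOME G. (\<forall>t. (G has_real_derivative rhs u t) (at t)) \<and> G 0 = 0)" for u
  have "\<exists>G. (\<forall>t. (G has_real_derivative rhs u t) (at t)) \<and> G 0 = 0" for u
    using real_antiderivative[OF rhs_cont[of u]] by metis
  then have "(\<forall>t. (I u has_real_derivative rhs u t) (at t)) \<and> I u 0 = 0" for u
    unfolding I_def by (rule someI_ex)
  then have I: "(I u has_real_derivative rhs u t) (at t)" "I u 0 = 0" for u t by auto
  have I_cont: "continuous_on UNIV (I u)" for u
    using I(1) by (meson DERIV_continuous continuous_at_imp_continuous_on)
  have I_bound: "\<bar>I u t\<bar> \<le> B / (2 * L) * w t" for u t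
    unfolding w_def
  proof (rule exp_growth[OF I(1) I(2)])
    fix s
    have "\<bar>rhs u s\<bar> \<le> B * 1" unfolding rhs_def using bound by simp
    also have "\<dots> \<le> B * exp (2 * L * \<bar>s\<bar>)"
      by (rule mult_left_mono) (use \<open>0 \<le> B\<close> \<open>L > 0\<close> in auto)
    finally show "\<bar>rhs u s\<bar> \<le> B * exp (2 * L * \<bar>s\<bar>)" .
  qed (use \<open>0 \<le> B\<close> \<open>L > 0\<close> in auto)
  define T where "T u = Bcontfun (\<lambda>t. I u t / w t)" for u
  have "(\<lambda>t. I u t / w t) \<in> bcontfun" for u
  proof (rule bcontfun_normI)
    show "continuous_on UNIV (\<lambda>t. I u t / w t)"
      using w_pos by (intro continuous_intros I_cont w_cont) (metis less_irrefl)
    show "norm (I u t / w t) \<le> B / (2 * L)" for t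
      using I_bound[of u t] w_pos[of t] by (simp add: field_simps)
  qed
  then have T: "apply_bcontfun (T u) t = I u t / w t" for u t
    unfolding T_def by (simp add: Bcontfun_inverse)
  have contr: "dist (T u) (T v) \<le> 1 / 2 * dist u v" for u v
  proof (rule dist_bound)
    fix t
    have "\<bar>I u t - I v t\<bar> \<le> L * dist u v / (2 * L) * exp (2 * L * \<bar>t\<bar>)"
    proof (rule exp_growth[where g="\<lambda>t. rhs u t - rhs v t"])
      fix s
      have "\<bar>rhs u s - rhs v s\<bar>
          \<le> L * \<bar>(x0 + w s * apply_bcontfun u s) - (x0 + w s * apply_bcontfun v s)\<bar>"
        unfolding rhs_def by (rule lip)
      also have "\<dots> = L * (w s * dist (apply_bcontfun u s) (apply_bcontfun v s))"
        using w_pos[of s] by (simp add: dist_real_def abs_mult flip: right_diff_distrib)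
      also have "\<dots> \<le> L * (w s * dist u v)"
        using w_pos[of s] \<open>L > 0\<close> by (intro mult_left_mono dist_bounded) auto
      finally show "\<bar>rhs u s - rhs v s\<bar> \<le> L * dist u v * exp (2 * L * \<bar>s\<bar>)"
        by (simp add: w_def ac_simps)
    qed (use I \<open>L > 0\<close> in \<open>auto intro!: derivative_intros\<close>)
    then have "\<bar>I u t - I v t\<bar> \<le> (1 / 2 * dist u v) * w t"
      using \<open>L > 0\<close> by (simp add: w_def)
    then show "dist (apply_bcontfun (T u) t) (apply_bcontfun (T v) t) \<le> 1 / 2 * dist u v"
      using w_pos[of t] unfolding T dist_real_def
      by (simp add: abs_divide pos_divide_le_eq flip: diff_divide_distrib)
  qed
  obtain u where u: "T u = u"
    using banach_fix_type[of "1/2" T] contr by auto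
  have eq: "w t * apply_bcontfun u t = I u t" for t
    using T[of u t] w_pos[of t] unfolding u by (simp add: field_simps)
  have "((\<lambda>t. x0 + I u t) has_real_derivative F t (x0 + I u t)) (at t)" for t
    using I(1)[of u t] unfolding rhs_def eq by (auto intro!: derivative_eq_intros)
  then show ?thesis
    by (intro that[of "\<lambda>t. x0 + I u t"]) (auto simp: I)
qed

lemma abs_cos_diff_le: "\<bar>cos x - cos y\<bar> \<le> \<bar>x - y\<bar>" for x y :: real
proof -
  have "\<bar>cos x - cos y\<bar> = 2 * \<bar>sin ((x + y) / 2)\<bar> * \<bar>sin ((y - x) / 2)\<bar>"
    by (simp add: cos_diff_cos abs_mult)
  also have "\<dots> \<le> 2 * 1 * \<bar>(y - x) / 2\<bar>"
    by (intro mult_mono abs_sin_x_le_abs_x) auto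
  finally show ?thesis by simp
qed

lemma abs_sin_diff_le: "\<bar>sin x - sin y\<bar> \<le> \<bar>x - y\<bar>" for x y :: real
  using abs_cos_diff_le[of "pi / 2 - x" "pi / 2 - y"] by (simp add: cos_sin_eq abs_minus_commute)

lemma josephson_exists:
  assumes "\<mu> > 0"
  obtains x where "josephson_solution a b \<mu> x" "x 0 = x0"
proof -
  have "continuous_on UNIV (\<lambda>(t, x). (cos x + a + b * cos t) / \<mu>)"
    unfolding case_prod_beta by (intro continuous_intros) (use assms in auto)
  moreover have "\<bar>(cos x + a + b * cos t) / \<mu>\<bar> \<le> (1 + \<bar>a\<bar> + \<bar>b\<bar>) / \<mu>" for t x :: real
  proof -
    have "\<bar>cos x + a + b * cos t\<bar> \<le> \<bar>cos x\<bar> + \<bar>a\<bar> + \<bar>b\<bar> * \<bar>cos t\<bar>"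
      by (simp flip: abs_mult)
    also have "\<dots> \<le> 1 + \<bar>a\<bar> + \<bar>b\<bar> * 1"
      by (intro add_mono mult_left_mono) auto
    finally show ?thesis using assms by (simp add: divide_right_mono)
  qed
  moreover have "\<bar>(cos x + a + b * cos t) / \<mu> - (cos y + a + b * cos t) / \<mu>\<bar> \<le> 1 / \<mu> * \<bar>x - y\<bar>"
    for t x y :: real
    using abs_cos_diff_le[of x y] assms by (simp add: divide_right_mono flip: diff_divide_distrib)
  ultimately show ?thesis
    using ode_exists[of "\<lambda>t x. (cos x + a + b * cos t) / \<mu>" _ "1 / \<mu>" x0] assms that
    unfolding josephson_solution_def by (metis divide_pos_pos zero_less_one)
qed

section \<open>Comparison of solutions and the period map\<close>

lemma has_derivative_neg_part_squared:
  "((\<lambda>r. (min r 0)\<^sup>2) has_real_derivative 2 * min r 0) (at (r::real))"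
proof -
  consider "r < 0" | "r > 0" | "r = 0" by linarith
  then show ?thesis
  proof cases
    case 1
    have "((\<lambda>r. r\<^sup>2) has_real_derivative 2 * min r 0) (at r)"
      using 1 by (auto intro!: derivative_eq_intros)
    then show ?thesis
      by (rule DERIV_cong_ev[THEN iffD1, rotated -1])
        (use 1 in \<open>auto intro: eventually_mono[OF eventually_nhds_in_open[of "{..<0}"]]\<close>)
  next
    case 2
    have "((\<lambda>r. 0) has_real_derivative 2 * min r 0) (at r)"
      using 2 by (auto intro!: derivative_eq_intros)
    then show ?thesis
      by (rule DERIV_cong_ev[THEN iffD1, rotated -1])
        (use 2 in \<open>auto intro: eventually_mono[OF eventually_nhds_in_open[of "{0<..}"]]\<close>)
  next
    case 3
    have "((\<lambda>h. (min h 0)\<^sup>2 / h) \<longlongrightarrow> 0) (at (0::real))"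
    proof (rule Lim_null_comparison)
      have "norm ((min h 0)\<^sup>2 / h) \<le> \<bar>h\<bar>" for h :: real
        by (cases "h < 0") (auto simp: power2_eq_square)
      then show "\<forall>\<^sub>F h in at 0. norm ((min h 0)\<^sup>2 / h) \<le> \<bar>h::real\<bar>" by simp
      show "((\<lambda>h::real. \<bar>h\<bar>) \<longlongrightarrow> 0) (at 0)"
        using tendsto_rabs_zero[OF tendsto_ident_at] .
    qed
    then show ?thesis using 3 by (simp add: DERIV_def)
  qed
qed

lemma linear_lower_comparison:
  fixes D d :: "real \<Rightarrow> real"
  assumes D: "\<And>t. (D has_real_derivative d t) (at t)"
    and d: "\<And>t. d t \<ge> c - L * \<bar>D t\<bar>"
    and "0 \<le> D 0" "0 \<le> c" "0 \<le> L" "0 \<le> t"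
  shows "0 \<le> D t" "D 0 + c * t \<le> D t * exp (L * t)"
proof -
  have nonneg: "0 \<le> D t" if "0 \<le> t" for t
  proof -
    have "(min (D t) 0)\<^sup>2 * exp (- 2 * L * t) \<le> (min (D 0) 0)\<^sup>2 * exp (- 2 * L * 0)"
    proof (rule DERIV_nonpos_imp_nonincreasing[OF that])
      fix s
      let ?n = "min (D s) 0"
      have "((\<lambda>t. (min (D t) 0)\<^sup>2) has_real_derivative 2 * ?n * d s) (at s)"
        by (rule DERIV_chain2[OF has_derivative_neg_part_squared D])
      moreover have "((\<lambda>t. exp (- 2 * L * t)) has_real_derivative
          - 2 * L * exp (- 2 * L * s)) (at s)"
        by (auto intro!: derivative_eq_intros)
      ultimately have "((\<lambda>t. (min (D t) 0)\<^sup>2 * exp (- 2 * L * t)) has_real_derivative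
          2 * ?n * (d s - L * ?n) * exp (- 2 * L * s)) (at s)"
        by (rule DERIV_cong[OF DERIV_mult]) (simp add: algebra_simps power2_eq_square)
      moreover have "2 * ?n * (d s - L * ?n) \<le> 0"
        using d[of s] \<open>0 \<le> c\<close> by (cases "D s < 0") (auto intro!: mult_nonpos_nonneg)
      ultimately show "\<exists>y. ((\<lambda>t. (min (D t) 0)\<^sup>2 * exp (- 2 * L * t)) has_real_derivative y) (at s)
          \<and> y \<le> 0"
        using mult_nonpos_nonneg exp_ge_zero by blast
    qed
    then have "(min (D t) 0)\<^sup>2 * exp (- 2 * L * t) \<le> 0" using \<open>0 \<le> D 0\<close> by simp
    then have "(min (D t) 0)\<^sup>2 \<le> 0" by (simp add: mult_le_0_iff)
    then show ?thesis by (simp add: min_def split: if_splits)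
  qed
  show "0 \<le> D t" using nonneg \<open>0 \<le> t\<close> by blast
  have "D 0 * exp (L * 0) - c * 0 \<le> D t * exp (L * t) - c * t"
  proof (rule DERIV_nonneg_imp_nondecreasing[OF \<open>0 \<le> t\<close>])
    fix s :: real assume "0 \<le> s"
    have "((\<lambda>t. D t * exp (L * t) - c * t) has_real_derivative
        (d s + L * D s) * exp (L * s) - c) (at s)"
      by (auto intro!: derivative_eq_intros D simp: algebra_simps)
    moreover have "c * 1 \<le> (d s + L * D s) * exp (L * s)"
      using d[of s] nonneg[OF \<open>0 \<le> s\<close>] \<open>0 \<le> c\<close> \<open>0 \<le> L\<close> \<open>0 \<le> s\<close> by (intro mult_mono) auto
    ultimately show "\<exists>y. ((\<lambda>t. D t * exp (L * t) - c * t) has_real_derivative y) (at s) \<and> 0 \<le> y"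
      by auto
  qed
  then show "D 0 + c * t \<le> D t * exp (L * t)" by simp
qed

lemma gronwall_squared:
  fixes D d :: "real \<Rightarrow> real"
  assumes D: "\<And>t. (D has_real_derivative d t) (at t)"
    and d: "\<And>t. \<bar>d t\<bar> \<le> L * \<bar>D t\<bar> + c"
    and "0 \<le> L" "0 \<le> t"
  shows "(D t)\<^sup>2 \<le> exp ((2 * L + 1) * t) * ((D 0)\<^sup>2 + c\<^sup>2 * t)"
proof -
  let ?M = "2 * L + 1"
  have "(D t)\<^sup>2 * exp (- ?M * t) - c\<^sup>2 * t \<le> (D 0)\<^sup>2 * exp (- ?M * 0) - c\<^sup>2 * 0"
  proof (rule DERIV_nonpos_imp_nonincreasing[OF \<open>0 \<le> t\<close>])
    fix s :: real assume "0 \<le> s"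
    have "((\<lambda>t. (D t)\<^sup>2 * exp (- ?M * t) - c\<^sup>2 * t) has_real_derivative
        (2 * D s * d s - ?M * (D s)\<^sup>2) * exp (- ?M * s) - c\<^sup>2) (at s)"
      by (auto intro!: derivative_eq_intros D simp: algebra_simps)
    moreover have "(2 * D s * d s - ?M * (D s)\<^sup>2) * exp (- ?M * s) \<le> c\<^sup>2 * 1"
    proof (rule mult_mono)
      have "D s * d s \<le> \<bar>D s\<bar> * (L * \<bar>D s\<bar> + c)"
        using d[of s] by (metis abs_ge_self abs_ge_zero abs_mult mult_left_mono order_trans)
      then have "2 * D s * d s \<le> 2 * L * (D s)\<^sup>2 + 2 * \<bar>D s\<bar> * c"
        by (simp add: algebra_simps power2_eq_square)
      also have "2 * \<bar>D s\<bar> * c \<le> (D s)\<^sup>2 + c\<^sup>2"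
        using sum_squares_bound[of "\<bar>D s\<bar>" c] by simp
      finally show "2 * D s * d s - ?M * (D s)\<^sup>2 \<le> c\<^sup>2" by (simp add: algebra_simps)
      have "0 \<le> ?M * s" using \<open>0 \<le> L\<close> \<open>0 \<le> s\<close> by simp
      then show "exp (- ?M * s) \<le> 1"
        by (metis exp_le_one_iff mult_minus_left neg_le_0_iff_le)
    qed auto
    ultimately show "\<exists>y. ((\<lambda>t. (D t)\<^sup>2 * exp (- ?M * t) - c\<^sup>2 * t) has_real_derivative y) (at s)
        \<and> y \<le> 0"
      by (intro exI conjI) auto
  qed
  then have "(D t)\<^sup>2 * exp (- ?M * t) \<le> (D 0)\<^sup>2 + c\<^sup>2 * t" by simp
  then have "exp (?M * t) * ((D t)\<^sup>2 * exp (- ?M * t)) \<le> exp (?M * t) * ((D 0)\<^sup>2 + c\<^sup>2 * t)"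
    by (intro mult_left_mono) auto
  moreover have "exp (?M * t) * ((D t)\<^sup>2 * exp (- ?M * t)) = (D t)\<^sup>2"
    by (simp add: mult.left_commute[of "exp (?M * t)"] algebra_simps flip: exp_add)
  ultimately show ?thesis by metis
qed

lemma josephson_diff_deriv:
  assumes "josephson_solution a b \<mu> x" "josephson_solution a' b \<mu> y"
  shows "((\<lambda>t. x t - y t) has_real_derivative (cos (x t) - cos (y t) + (a - a')) / \<mu>) (at t)"
proof -
  have "((\<lambda>t. x t - y t) has_real_derivative
      (cos (x t) + a + b * cos t) / \<mu> - (cos (y t) + a' + b * cos t) / \<mu>) (at t)"
    using assms unfolding josephson_solution_def by (intro DERIV_diff) auto
  then show ?thesis by (simp add: diff_divide_distrib[symmetric] algebra_simps)
qed

lemma josephson_close: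
  assumes "\<mu> > 0" "josephson_solution a b \<mu> x" "josephson_solution a' b \<mu> y" "0 \<le> t"
  shows "(x t - y t)\<^sup>2 \<le> exp ((2 / \<mu> + 1) * t) * ((x 0 - y 0)\<^sup>2 + (\<bar>a - a'\<bar> / \<mu>)\<^sup>2 * t)"
proof -
  have "\<bar>(cos (x t) - cos (y t) + (a - a')) / \<mu>\<bar> \<le> 1 / \<mu> * \<bar>x t - y t\<bar> + \<bar>a - a'\<bar> / \<mu>" for t
  proof -
    have "\<bar>cos (x t) - cos (y t) + (a - a')\<bar> \<le> \<bar>x t - y t\<bar> + \<bar>a - a'\<bar>"
      using abs_cos_diff_le[of "x t" "y t"] by linarith
    then show ?thesis using \<open>\<mu> > 0\<close> by (simp add: divide_right_mono flip: add_divide_distrib)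
  qed
  from gronwall_squared[OF josephson_diff_deriv[OF assms(2,3)] this, of t] assms
  show ?thesis by simp
qed

lemma josephson_comparison:
  assumes "\<mu> > 0" "josephson_solution a b \<mu> x" "josephson_solution a' b \<mu> y" "0 \<le> t"
    and "a' \<le> a" "y 0 \<le> x 0"
  shows "y t \<le> x t" "(a - a') / \<mu> * t \<le> (x t - y t) * exp (t / \<mu>)"
proof -
  have *: "(a - a') / \<mu> - 1 / \<mu> * \<bar>x t - y t\<bar> \<le> (cos (x t) - cos (y t) + (a - a')) / \<mu>" for t
    using abs_cos_diff_le[of "x t" "y t"] \<open>\<mu> > 0\<close>
    by (simp add: divide_right_mono flip: diff_divide_distrib)
  show "y t \<le> x t" "(a - a') / \<mu> * t \<le> (x t - y t) * exp (t / \<mu>)"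
    using linear_lower_comparison[OF josephson_diff_deriv[OF assms(2,3)] *, of t] assms
    by simp_all
qed

lemma poincare_lift_eq:
  assumes "\<mu> > 0" "josephson_solution a b \<mu> x"
  shows "poincare_lift a b \<mu> (x 0) = x (2 * pi)"
  unfolding poincare_lift_def
proof (rule the_equality)
  fix y assume "\<exists>z. josephson_solution a b \<mu> z \<and> z 0 = x 0 \<and> z (2 * pi) = y"
  then obtain z where "josephson_solution a b \<mu> z" "z 0 = x 0" "z (2 * pi) = y" by blast
  then show "y = x (2 * pi)" using josephson_close[OF assms(1) _ assms(2), of a z "2 * pi"] by simp
qed (use assms in auto)

lemma poincare_lift_solution:
  assumes "\<mu> > 0"
  obtains x where "josephson_solution a b \<mu> x" "x 0 = x0" "x (2 * pi) = poincare_lift a b \<mu> x0"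
  using josephson_exists[OF assms, of a b x0] poincare_lift_eq[OF assms] by metis

lemma poincare_lift_mono:
  assumes "\<mu> > 0" "x0 \<le> y0"
  shows "poincare_lift a b \<mu> x0 \<le> poincare_lift a b \<mu> y0"
proof -
  obtain x where "josephson_solution a b \<mu> x" "x 0 = x0" "x (2 * pi) = poincare_lift a b \<mu> x0"
    using poincare_lift_solution[OF assms(1)] .
  moreover obtain y where "josephson_solution a b \<mu> y" "y 0 = y0" "y (2 * pi) = poincare_lift a b \<mu> y0"
    using poincare_lift_solution[OF assms(1)] .
  ultimately show ?thesis using josephson_comparison(1)[of \<mu> a b y a x "2 * pi"] assms by simp
qed

lemma poincare_lift_strict_mono_param:
  assumes "\<mu> > 0" "a' < a"
  shows "poincare_lift a' b \<mu> x0 < poincare_lift a b \<mu> x0"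
proof -
  obtain x where "josephson_solution a b \<mu> x" "x 0 = x0" "x (2 * pi) = poincare_lift a b \<mu> x0"
    using poincare_lift_solution[OF assms(1)] .
  moreover obtain y where "josephson_solution a' b \<mu> y" "y 0 = x0" "y (2 * pi) = poincare_lift a' b \<mu> x0"
    using poincare_lift_solution[OF assms(1)] .
  ultimately have "(a - a') / \<mu> * (2 * pi)
      \<le> (poincare_lift a b \<mu> x0 - poincare_lift a' b \<mu> x0) * exp (2 * pi / \<mu>)"
    using josephson_comparison(2)[of \<mu> a b x a' y "2 * pi"] assms by simp
  moreover have "(a - a') / \<mu> * (2 * pi) > 0" using assms by simp
  ultimately show ?thesis
    by (smt (verit) exp_gt_zero mult_nonpos_nonneg)
qed

lemma poincare_lift_close:
  assumes "\<mu> > 0"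
  shows "(poincare_lift a b \<mu> x0 - poincare_lift a' b \<mu> y0)\<^sup>2
    \<le> exp ((2 / \<mu> + 1) * (2 * pi)) * ((x0 - y0)\<^sup>2 + (\<bar>a - a'\<bar> / \<mu>)\<^sup>2 * (2 * pi))"
proof -
  obtain x where "josephson_solution a b \<mu> x" "x 0 = x0" "x (2 * pi) = poincare_lift a b \<mu> x0"
    using poincare_lift_solution[OF assms(1)] .
  moreover obtain y where "josephson_solution a' b \<mu> y" "y 0 = y0" "y (2 * pi) = poincare_lift a' b \<mu> y0"
    using poincare_lift_solution[OF assms(1)] .
  ultimately show ?thesis using josephson_close[of \<mu> a b x a' y "2 * pi"] assms by simp
qed

lemma continuous_on_if_sq_le:
  fixes f :: "real \<Rightarrow> real"
  assumes "\<And>x y. (f x - f y)\<^sup>2 \<le> C * (x - y)\<^sup>2"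
  shows "continuous_on UNIV f"
proof (rule lipschitz_on_continuous_on[OF lipschitz_onI])
  fix x y
  have "0 \<le> C" using assms[of 1 0] by (simp add: order_trans[OF zero_le_power2])
  have "sqrt ((f x - f y)\<^sup>2) \<le> sqrt (C * (x - y)\<^sup>2)"
    by (rule real_sqrt_le_mono[OF assms])
  then show "dist (f x) (f y) \<le> sqrt \<bar>C\<bar> * dist x y"
    using \<open>0 \<le> C\<close> by (simp add: real_sqrt_mult dist_real_def)
qed simp

lemma continuous_on_poincare_lift:
  assumes "\<mu> > 0"
  shows "continuous_on UNIV (poincare_lift a b \<mu>)"
  using poincare_lift_close[OF assms, of a b _ a] by (intro continuous_on_if_sq_le) simp

lemma continuous_on_poincare_lift_param:
  assumes "\<mu> > 0"
  shows "continuous_on UNIV (\<lambda>a. poincare_lift a b \<mu> x0)"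
  by (rule continuous_on_if_sq_le[where C = "exp ((2 / \<mu> + 1) * (2 * pi)) * (1 / \<mu>\<^sup>2 * (2 * pi))"])
    (use poincare_lift_close[OF assms, of _ b x0 _ x0] in \<open>simp add: power_divide mult_ac\<close>)

lemma poincare_lift_add_period:
  assumes "\<mu> > 0"
  shows "poincare_lift a b \<mu> (x0 + 2 * pi * of_int j) = poincare_lift a b \<mu> x0 + 2 * pi * of_int j"
proof -
  obtain x where x: "josephson_solution a b \<mu> x" "x 0 = x0" "x (2 * pi) = poincare_lift a b \<mu> x0"
    using poincare_lift_solution[OF assms] .
  have "cos (x t + 2 * pi * of_int j) = cos (x t)" for t
    by (simp add: cos_add)
  then have "josephson_solution a b \<mu> (\<lambda>t. x t + 2 * pi * of_int j)"
    using x(1) unfolding josephson_solution_def by (auto intro!: derivative_eq_intros)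
  from poincare_lift_eq[OF assms this] x show ?thesis by simp
qed

lemma poincare_lift_reflect:
  assumes "\<mu> > 0" "poincare_lift a b \<mu> x0 = x0 + 2 * pi * of_int k"
  shows "poincare_lift a b \<mu> (- x0) = - x0 + 2 * pi * of_int k"
proof -
  obtain x where x: "josephson_solution a b \<mu> x" "x 0 = x0" "x (2 * pi) = poincare_lift a b \<mu> x0"
    using poincare_lift_solution[OF assms(1)] .
  let ?y = "\<lambda>t. 2 * pi * of_int k - x (2 * pi - t)"
  have "josephson_solution a b \<mu> ?y"
    unfolding josephson_solution_def
  proof
    fix t
    have "(x has_real_derivative (cos (x (2 * pi - t)) + a + b * cos (2 * pi - t)) / \<mu>) (at (2 * pi - t))"
      using x(1) unfolding josephson_solution_def by blast
    moreover have "((\<lambda>t. 2 * pi - t) has_real_derivative - 1) (at t)"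
      by (auto intro!: derivative_eq_intros)
    ultimately have "((\<lambda>t. x (2 * pi - t)) has_real_derivative
        (cos (x (2 * pi - t)) + a + b * cos (2 * pi - t)) / \<mu> * - 1) (at t)"
      by (rule DERIV_chain2)
    then have "((\<lambda>t. x (2 * pi - t)) has_real_derivative
        - ((cos (x (2 * pi - t)) + a + b * cos t) / \<mu>)) (at t)"
      by (simp add: cos_diff)
    moreover have "cos (?y t) = cos (x (2 * pi - t))" by (simp add: cos_diff)
    ultimately show "(?y has_real_derivative (cos (?y t) + a + b * cos t) / \<mu>) (at t)"
      by (auto intro!: derivative_eq_intros)
  qed
  from poincare_lift_eq[OF assms(1) this] x assms(2) show ?thesis by simp
qed

section \<open>Tongue sections\<close>

lemma half_sine_deriv:
  assumes "josephson_solution a b \<mu> x" "josephson_solution a b \<mu> y"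
  shows "((\<lambda>t. sin ((x t - y t) / 2)) has_real_derivative
    - ((sin (x t) + sin (y t)) / (2 * \<mu>)) * sin ((x t - y t) / 2)) (at t)"
proof -
  have "((\<lambda>t. sin ((x t - y t) / 2)) has_real_derivative
      cos ((x t - y t) / 2) * ((cos (x t) - cos (y t)) / \<mu> / 2)) (at t)"
    using DERIV_chain2[OF DERIV_sin DERIV_cdivide[OF josephson_diff_deriv[OF assms], of 2]] by simp
  moreover have "cos ((x t - y t) / 2) * (cos (x t) - cos (y t))
      = - ((sin (x t) + sin (y t)) * sin ((x t - y t) / 2))"
  proof -
    have "sin ((y t - x t) / 2) = - sin ((x t - y t) / 2)"
      by (metis minus_diff_eq minus_divide_left sin_minus)
    then show ?thesis
      unfolding cos_diff_cos[of "x t"] sin_plus_sin[of "x t"] by simp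
  qed
  then have "cos ((x t - y t) / 2) * ((cos (x t) - cos (y t)) / \<mu> / 2)
      = - ((sin (x t) + sin (y t)) / (2 * \<mu>)) * sin ((x t - y t) / 2)"
    by (simp add: mult.commute)
  ultimately show ?thesis by simp
qed

text \<open>The equation is a Riccati equation for \<open>tan (x / 2)\<close>; this is the factorised form of the
  invariance of the cross-ratio.\<close>

lemma poincare_lift_half_sine:
  assumes "\<mu> > 0"
  obtains E where "\<And>x. E x > 0"
    "\<And>x y. sin ((poincare_lift a b \<mu> x - poincare_lift a b \<mu> y) / 2) = E x * E y * sin ((x - y) / 2)"
proof -
  have "\<exists>X. josephson_solution a b \<mu> X \<and> X 0 = x \<and> X (2 * pi) = poincare_lift a b \<mu> x" for x
    using poincare_lift_solution[OF assms] by metis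
  then obtain X where X: "josephson_solution a b \<mu> (X x)" "X x 0 = x"
    "X x (2 * pi) = poincare_lift a b \<mu> x" for x
    by metis
  have X_cont: "continuous_on UNIV (X x)" for x
    using X(1) unfolding josephson_solution_def
    by (meson DERIV_continuous continuous_at_imp_continuous_on)
  have "continuous_on UNIV (\<lambda>t. sin (X x t) / (2 * \<mu>))" for x
    by (intro continuous_intros X_cont) (use assms in auto)
  from real_antiderivative[OF this]
  have "\<exists>M. (\<forall>t. (M has_real_derivative sin (X x t) / (2 * \<mu>)) (at t)) \<and> M 0 = 0" for x
    by blast
  then obtain M where M: "(M x has_real_derivative sin (X x t) / (2 * \<mu>)) (at t)" "M x 0 = 0" for x t
    by metis
  have "sin ((X x (2 * pi) - X y (2 * pi)) / 2) * exp (M x (2 * pi) + M y (2 * pi))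
      = sin ((X x 0 - X y 0) / 2) * exp (M x 0 + M y 0)" for x y
  proof (rule DERIV_isconst_all[rule_format,
        where f = "\<lambda>t. sin ((X x t - X y t) / 2) * exp (M x t + M y t)" and x = "2 * pi" and y = 0])
    fix t
    define q where "q = (sin (X x t) + sin (X y t)) / (2 * \<mu>)"
    have dexp: "((\<lambda>t. exp (M x t + M y t)) has_real_derivative q * exp (M x t + M y t)) (at t)"
      unfolding q_def by (rule derivative_eq_intros refl M)+ (simp add: add_divide_distrib)
    have dsin: "((\<lambda>t. sin ((X x t - X y t) / 2)) has_real_derivative
        - q * sin ((X x t - X y t) / 2)) (at t)"
      unfolding q_def by (rule half_sine_deriv[OF X(1) X(1)])
    show "((\<lambda>t. sin ((X x t - X y t) / 2) * exp (M x t + M y t)) has_real_derivative 0) (at t)"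
      using DERIV_mult[OF dsin dexp] by simp
  qed
  then have "sin ((poincare_lift a b \<mu> x - poincare_lift a b \<mu> y) / 2)
      * (exp (M x (2 * pi)) * exp (M y (2 * pi))) = sin ((x - y) / 2)" for x y
    by (simp add: X M exp_add)
  then have "sin ((poincare_lift a b \<mu> x - poincare_lift a b \<mu> y) / 2)
      = exp (- M x (2 * pi)) * exp (- M y (2 * pi)) * sin ((x - y) / 2)" for x y
    by (simp add: exp_minus field_simps)
  then show ?thesis by (intro that[of "\<lambda>x. exp (- M x (2 * pi))"]) auto
qed

lemma three_fixed_points:
  assumes "\<mu> > 0" "0 < y" "y < x" "x < z" "z < pi"
    and y: "poincare_lift a b \<mu> y = y + 2 * pi * of_int k"
    and z: "poincare_lift a b \<mu> z = z + 2 * pi * of_int k"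
  shows "poincare_lift a b \<mu> x = x + 2 * pi * of_int k"
proof -
  obtain E where E: "\<And>x. E x > 0"
    "\<And>x y. sin ((poincare_lift a b \<mu> x - poincare_lift a b \<mu> y) / 2) = E x * E y * sin ((x - y) / 2)"
    using poincare_lift_half_sine[OF assms(1)] by metis
  have one: "E u * E v = 1"
    if "poincare_lift a b \<mu> u = u + 2 * pi * of_int k" "poincare_lift a b \<mu> v = v + 2 * pi * of_int k"
      "0 < (u - v) / 2" "(u - v) / 2 < pi" for u v
    using E(2)[of u v] sin_gt_zero[OF that(3,4)] that(1,2) by simp
  have "E y * E (- y) = 1" "E z * E (- y) = 1" "E z * E y = 1"
    using one[OF y poincare_lift_reflect[OF assms(1) y]] one[OF z poincare_lift_reflect[OF assms(1) y]]
      one[OF z y] assms by simp_all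
  moreover from this have eq: "E y = E z"
    using E(1)[of "- y"] by (metis mult_right_cancel less_irrefl)
  ultimately have "(E z)\<^sup>2 = 1" by (simp add: power2_eq_square)
  then have "E z = 1" using E(1)[of z] by (auto simp: power2_eq_1_iff)
  with eq have "E y = 1" by simp
  let ?w = "poincare_lift a b \<mu> x - 2 * pi * of_int k"
  have w: "y \<le> ?w" "?w \<le> z"
    using poincare_lift_mono[OF assms(1), of y x a b] poincare_lift_mono[OF assms(1), of x z a b]
      assms by auto
  have "poincare_lift a b \<mu> x - poincare_lift a b \<mu> y = ?w - y"
    "poincare_lift a b \<mu> z - poincare_lift a b \<mu> x = z - ?w" using y z by simp_all
  then have s: "sin ((?w - y) / 2) = E x * sin ((x - y) / 2)" "sin ((z - ?w) / 2) = E x * sin ((z - x) / 2)"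
    using E(2)[of x y] E(2)[of z x] \<open>E y = 1\<close> \<open>E z = 1\<close> by (simp_all only: mult_1 mult_1_right)
  have pos: "sin ((x - y) / 2) > 0" "sin ((z - x) / 2) > 0"
    using assms by (auto intro!: sin_gt_zero)
  have "?w = x"
  proof (rule ccontr)
    assume "?w \<noteq> x"
    then consider "?w < x" | "x < ?w" by linarith
    then show False
    proof cases
      case 1
      have "sin ((?w - y) / 2) < sin ((x - y) / 2)" "sin ((z - ?w) / 2) > sin ((z - x) / 2)"
        using w assms 1 by (auto intro!: sin_monotone_2pi)
      then show False using s pos by simp
    next
      case 2
      have "sin ((?w - y) / 2) > sin ((x - y) / 2)" "sin ((z - ?w) / 2) < sin ((z - x) / 2)"
        using w assms 2 by (auto intro!: sin_monotone_2pi)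
      then show False using s pos by simp
    qed
  qed
  then show ?thesis by simp
qed

lemma poincare_lift_iterate:
  assumes "\<mu> > 0" "poincare_lift a b \<mu> x = x + 2 * pi * of_int k"
  shows "(poincare_lift a b \<mu> ^^ n) x = x + 2 * pi * of_int k * of_nat n"
proof (induction n)
  case (Suc n)
  have "poincare_lift a b \<mu> (x + 2 * pi * of_int (k * int n))
      = x + 2 * pi * of_int k + 2 * pi * of_int (k * int n)"
    unfolding poincare_lift_add_period[OF assms(1)] assms(2) ..
  moreover have "(poincare_lift a b \<mu> ^^ n) x = x + 2 * pi * of_int (k * int n)"
    using Suc by simp
  ultimately show ?case by (simp add: algebra_simps)
qed simp

lemma poincare_lift_iterate_mono:
  assumes "\<mu> > 0" "x \<le> y"
  shows "(poincare_lift a b \<mu> ^^ n) x \<le> (poincare_lift a b \<mu> ^^ n) y"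
  by (induction n) (use assms poincare_lift_mono in auto)

lemma rotation_number_fixed_point:
  assumes "\<mu> > 0" and fp: "poincare_lift a b \<mu> x0 = x0 + 2 * pi * of_int k"
  shows "has_rotation_number a b \<mu> (of_int k)"
  unfolding has_rotation_number_def
proof
  fix x
  let ?P = "poincare_lift a b \<mu>"
  define j where "j = \<lfloor>(x - x0) / (2 * pi)\<rfloor>"
  have j: "x0 + 2 * pi * of_int j \<le> x" "x \<le> x0 + 2 * pi * of_int (j + 1)"
    using floor_divide_lower[of "2 * pi" "x - x0"] floor_divide_upper[of "2 * pi" "x - x0"]
    unfolding j_def by (auto simp: algebra_simps)
  have fpj: "?P (x0 + 2 * pi * of_int i) = x0 + 2 * pi * of_int i + 2 * pi * of_int k" for i
    using poincare_lift_add_period[OF assms(1)] fp by simp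
  have bound: "\<bar>(?P ^^ n) x - x - 2 * pi * of_int k * of_nat n\<bar> \<le> 2 * pi" for n
    using poincare_lift_iterate_mono[OF assms(1) j(1), where n = n and a = a and b = b]
      poincare_lift_iterate_mono[OF assms(1) j(2), where n = n and a = a and b = b] j
    unfolding poincare_lift_iterate[OF assms(1) fpj]
    by (auto simp: abs_le_iff algebra_simps)
  have "(\<lambda>n. ((?P ^^ n) x - x - 2 * pi * of_int k * of_nat n) / (2 * pi * real n)) \<longlonglongrightarrow> 0"
  proof (rule Lim_null_comparison)
    show "\<forall>\<^sub>F n in sequentially.
        norm (((?P ^^ n) x - x - 2 * pi * of_int k * of_nat n) / (2 * pi * real n)) \<le> 1 / real n"
    proof (rule eventually_mono[OF eventually_gt_at_top[of 0]])
      fix n :: nat assume "0 < n"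
      then show "norm (((?P ^^ n) x - x - 2 * pi * of_int k * of_nat n) / (2 * pi * real n)) \<le> 1 / real n"
        using bound[of n] by (simp add: abs_divide abs_mult divide_le_eq)
    qed
    show "(\<lambda>n. 1 / real n) \<longlonglongrightarrow> 0" by (rule lim_1_over_n)
  qed
  then have "(\<lambda>n. ((?P ^^ n) x - x - 2 * pi * of_int k * of_nat n) / (2 * pi * real n) + of_int k)
      \<longlonglongrightarrow> 0 + of_int k"
    by (intro tendsto_intros)
  moreover have "\<forall>\<^sub>F n in sequentially.
      ((?P ^^ n) x - x - 2 * pi * of_int k * of_nat n) / (2 * pi * real n) + of_int k
      = ((?P ^^ n) x - x) / (2 * pi * real n)"
    using eventually_gt_at_top[of 0] by eventually_elim (simp add: field_simps)
  ultimately show "(\<lambda>n. ((?P ^^ n) x - x) / (2 * pi * real n)) \<longlonglongrightarrow> of_int k"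
    using Lim_transform_eventually by force
qed

lemma rotation_number_unique:
  assumes "has_rotation_number a b \<mu> r" "has_rotation_number a b \<mu> s"
  shows "r = s"
  by (rule LIMSEQ_unique[OF assms[unfolded has_rotation_number_def, THEN spec, of 0]])

lemma ivt_between:
  fixes f :: "real \<Rightarrow> real"
  assumes cont: "continuous_on UNIV f" and "f x \<le> 0" "0 \<le> f y"
  obtains z where "min x y \<le> z" "z \<le> max x y" "f z = 0"
proof (cases "x \<le> y")
  case True
  then show ?thesis
    using IVT'[OF assms(2,3) True continuous_on_subset[OF cont]] that by (metis max_def min_def subset_UNIV)
next
  case False
  then have "y \<le> x" by simp
  then show ?thesis
    using IVT2'[OF assms(2,3) _ continuous_on_subset[OF cont]] that False
    by (metis max_def min_def subset_UNIV)
qed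

lemma displacement_sign:
  assumes "\<mu> > 0" and no_fp: "\<And>x. poincare_lift a b \<mu> x \<noteq> x + 2 * pi * of_int k"
  obtains \<epsilon> where "\<epsilon> > 0" "(\<forall>x. poincare_lift a b \<mu> x \<ge> x + 2 * pi * of_int k + \<epsilon>)
    \<or> (\<forall>x. poincare_lift a b \<mu> x \<le> x + 2 * pi * of_int k - \<epsilon>)"
proof -
  define d where "d x = poincare_lift a b \<mu> x - x - 2 * pi * of_int k" for x
  have d_cont: "continuous_on A d" for A
    unfolding d_def
    by (intro continuous_intros continuous_on_subset[OF continuous_on_poincare_lift[OF assms(1)]]) auto
  have d_nz: "d x \<noteq> 0" for x using no_fp[of x] by (simp add: d_def)
  have "d (x + 2 * pi * of_int j) = d x" for x j
    using poincare_lift_add_period[OF assms(1)] by (simp add: d_def)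
  then have red: "\<exists>y\<in>{0..2*pi}. d x = d y" for x
  proof -
    let ?y = "x - 2 * pi * of_int \<lfloor>x / (2 * pi)\<rfloor>"
    have "?y \<in> {0..2*pi}"
      using floor_divide_lower[of "2 * pi" x] floor_divide_upper[of "2 * pi" x]
      by (auto simp: algebra_simps)
    moreover have "d x = d ?y"
      using \<open>\<And>x j. d (x + 2 * pi * of_int j) = d x\<close>[of ?y "\<lfloor>x / (2 * pi)\<rfloor>"] by simp
    ultimately show ?thesis by blast
  qed
  have "\<exists>m\<in>{0..2*pi}. \<forall>y\<in>{0..2*pi}. \<bar>d m\<bar> \<le> \<bar>d y\<bar>"
    by (rule continuous_attains_inf) (auto intro!: continuous_on_rabs d_cont)
  then obtain m where m: "\<And>y. y \<in> {0..2*pi} \<Longrightarrow> \<bar>d m\<bar> \<le> \<bar>d y\<bar>"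
    by blast
  have big: "\<bar>d m\<bar> \<le> \<bar>d x\<bar>" for x using m red by metis
  have same: "d x > 0" if "d 0 > 0" for x
    using ivt_between[OF d_cont[of UNIV], of x 0] d_nz that by (metis less_imp_le not_less)
  have same': "d x < 0" if "d 0 < 0" for x
    using ivt_between[OF d_cont[of UNIV], of 0 x] d_nz that by (metis less_imp_le not_less)
  show ?thesis
  proof (rule that[of "\<bar>d m\<bar>"])
    show "\<bar>d m\<bar> > 0" using d_nz by simp
    consider "d 0 > 0" | "d 0 < 0" using d_nz[of 0] by linarith
    then show "(\<forall>x. poincare_lift a b \<mu> x \<ge> x + 2 * pi * of_int k + \<bar>d m\<bar>)
      \<or> (\<forall>x. poincare_lift a b \<mu> x \<le> x + 2 * pi * of_int k - \<bar>d m\<bar>)"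
    proof cases
      case 1
      have "poincare_lift a b \<mu> x \<ge> x + 2 * pi * of_int k + \<bar>d m\<bar>" for x
        using big[of x] same[OF 1, of x] unfolding d_def[of x] by linarith
      then show ?thesis by blast
    next
      case 2
      have "poincare_lift a b \<mu> x \<le> x + 2 * pi * of_int k - \<bar>d m\<bar>" for x
        using big[of x] same'[OF 2, of x] unfolding d_def[of x] by linarith
      then show ?thesis by blast
    qed
  qed
qed

lemma has_rotation_number_iff_fixed_point:
  assumes "\<mu> > 0"
  shows "has_rotation_number a b \<mu> (of_int k) \<longleftrightarrow> (\<exists>x. poincare_lift a b \<mu> x = x + 2 * pi * of_int k)"
proof
  let ?P = "poincare_lift a b \<mu>"
  assume rot: "has_rotation_number a b \<mu> (of_int k)"
  show "\<exists>x. ?P x = x + 2 * pi * of_int k"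
  proof (rule ccontr)
    assume "\<nexists>x. ?P x = x + 2 * pi * of_int k"
    then obtain \<epsilon> where "\<epsilon> > 0" and \<epsilon>: "(\<forall>x. ?P x \<ge> x + 2 * pi * of_int k + \<epsilon>)
        \<or> (\<forall>x. ?P x \<le> x + 2 * pi * of_int k - \<epsilon>)"
      using displacement_sign[OF assms] by metis
    have lim: "(\<lambda>n. ((?P ^^ n) 0 - 0) / (2 * pi * real n)) \<longlonglongrightarrow> of_int k"
      using rot unfolding has_rotation_number_def by blast
    from \<epsilon> show False
    proof
      assume ge: "\<forall>x. ?P x \<ge> x + 2 * pi * of_int k + \<epsilon>"
      have it: "(?P ^^ n) 0 \<ge> (2 * pi * of_int k + \<epsilon>) * real n" for n
      proof (induction n)
        case (Suc n)
        then show ?case using ge[rule_format, of "(?P ^^ n) 0"] by (simp add: algebra_simps)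
      qed simp
      have "of_int k + \<epsilon> / (2 * pi) \<le> ((?P ^^ n) 0 - 0) / (2 * pi * real n)" if "n \<ge> 1" for n
      proof -
        have eq: "(of_int k + \<epsilon> / (2 * pi)) * (2 * pi * real n) = (2 * pi * of_int k + \<epsilon>) * real n"
          by (simp add: field_simps)
        have pos: "0 < 2 * pi * real n" using that by simp
        show ?thesis unfolding pos_le_divide_eq[OF pos] eq using it[of n] by simp
      qed
      then have "of_int k + \<epsilon> / (2 * pi) \<le> of_int k"
        by (intro LIMSEQ_le_const[OF lim]) blast
      then show False using divide_pos_pos[OF \<open>\<epsilon> > 0\<close>, of "2 * pi"] by simp
    next
      assume le: "\<forall>x. ?P x \<le> x + 2 * pi * of_int k - \<epsilon>"
      have it: "(?P ^^ n) 0 \<le> (2 * pi * of_int k - \<epsilon>) * real n" for n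
      proof (induction n)
        case (Suc n)
        then show ?case using le[rule_format, of "(?P ^^ n) 0"] by (simp add: algebra_simps)
      qed simp
      have "((?P ^^ n) 0 - 0) / (2 * pi * real n) \<le> of_int k - \<epsilon> / (2 * pi)" if "n \<ge> 1" for n
      proof -
        have eq: "(of_int k - \<epsilon> / (2 * pi)) * (2 * pi * real n) = (2 * pi * of_int k - \<epsilon>) * real n"
          by (simp add: field_simps)
        have pos: "0 < 2 * pi * real n" using that by simp
        show ?thesis unfolding pos_divide_le_eq[OF pos] eq using it[of n] by simp
      qed
      then have "of_int k \<le> of_int k - \<epsilon> / (2 * pi)"
        by (intro LIMSEQ_le_const2[OF lim]) blast
      then show False using divide_pos_pos[OF \<open>\<epsilon> > 0\<close>, of "2 * pi"] by simp
    qed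
  qed
qed (use rotation_number_fixed_point[OF assms] in blast)

lemma exists_param_fixing:
  assumes "\<mu> > 0"
  obtains a where "poincare_lift a b \<mu> \<theta> = \<theta> + 2 * pi * of_int k"
proof -
  define f where "f a = poincare_lift a b \<mu> \<theta> - (\<theta> + 2 * pi * of_int k)" for a
  have f_cont: "continuous_on UNIV f"
    unfolding f_def by (intro continuous_intros continuous_on_poincare_lift_param assms)
  have drift: "((\<lambda>t. x t - of_int k * t - b / \<mu> * sin t) has_real_derivative (cos (x t) + c) / \<mu>) (at t)"
    if "josephson_solution (of_int k * \<mu> + c) b \<mu> x" for x c t
  proof -
    have "(x has_real_derivative (cos (x t) + (of_int k * \<mu> + c) + b * cos t) / \<mu>) (at t)"
      using that unfolding josephson_solution_def by blast
    then show ?thesis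
      using assms by (auto intro!: derivative_eq_intros simp: field_simps)
  qed
  have "f (of_int k * \<mu> + - 1) \<le> 0"
  proof -
    obtain x where x: "josephson_solution (of_int k * \<mu> + - 1) b \<mu> x" "x 0 = \<theta>"
      "x (2 * pi) = poincare_lift (of_int k * \<mu> + - 1) b \<mu> \<theta>"
      using poincare_lift_solution[OF assms] .
    have "x (2 * pi) - of_int k * (2 * pi) - b / \<mu> * sin (2 * pi) \<le> x 0 - of_int k * 0 - b / \<mu> * sin 0"
      by (rule DERIV_nonpos_imp_nonincreasing[of 0 "2 * pi"])
        (use drift[OF x(1)] assms in \<open>auto intro!: exI divide_nonpos_pos simp: add.commute\<close>)
    then show ?thesis using x by (simp add: f_def algebra_simps)
  qed
  moreover have "0 \<le> f (of_int k * \<mu> + 1)"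
  proof -
    obtain x where x: "josephson_solution (of_int k * \<mu> + 1) b \<mu> x" "x 0 = \<theta>"
      "x (2 * pi) = poincare_lift (of_int k * \<mu> + 1) b \<mu> \<theta>"
      using poincare_lift_solution[OF assms] .
    have "x 0 - of_int k * 0 - b / \<mu> * sin 0 \<le> x (2 * pi) - of_int k * (2 * pi) - b / \<mu> * sin (2 * pi)"
    proof (rule DERIV_nonneg_imp_nondecreasing[of 0 "2 * pi"])
      fix t
      have "0 \<le> (cos (x t) + 1) / \<mu>"
        using assms cos_ge_minus_one[of "x t"] by (intro divide_nonneg_pos) linarith+
      then show "\<exists>y. ((\<lambda>t. x t - of_int k * t - b / \<mu> * sin t) has_real_derivative y) (at t) \<and> 0 \<le> y"
        using drift[OF x(1)] by blast
    qed simp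
    then show ?thesis using x by (simp add: f_def algebra_simps)
  qed
  ultimately obtain a where "f a = 0"
    using ivt_between[OF f_cont] by metis
  then show ?thesis using that[of a] by (simp add: f_def)
qed

lemma fixed_point_reduce:
  assumes "\<mu> > 0" "poincare_lift a b \<mu> x = x + 2 * pi * of_int k"
  obtains y where "0 \<le> y" "y \<le> pi" "poincare_lift a b \<mu> y = y + 2 * pi * of_int k"
proof -
  define j where "j = \<lfloor>x / (2 * pi)\<rfloor>"
  define y where "y = x + 2 * pi * of_int (- j)"
  have y: "0 \<le> y" "y \<le> 2 * pi"
    using floor_divide_lower[of "2 * pi" x] floor_divide_upper[of "2 * pi" x]
    by (auto simp: y_def j_def algebra_simps)
  have fp: "poincare_lift a b \<mu> y = y + 2 * pi * of_int k"
    unfolding y_def poincare_lift_add_period[OF assms(1)] assms(2) by simp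
  show ?thesis
  proof (cases "y \<le> pi")
    case True
    then show ?thesis using that y fp by blast
  next
    case False
    have "poincare_lift a b \<mu> (- y + 2 * pi * of_int 1) = (- y + 2 * pi * of_int 1) + 2 * pi * of_int k"
      unfolding poincare_lift_add_period[OF assms(1)] poincare_lift_reflect[OF assms(1) fp] by simp
    then show ?thesis using that[of "- y + 2 * pi * of_int 1"] y False by simp
  qed
qed

lemma tongue_section_eq_segment:
  assumes "\<mu> > 0"
    and a0: "poincare_lift a0 b \<mu> 0 = 0 + 2 * pi * of_int k"
    and api: "poincare_lift a\<pi> b \<mu> pi = pi + 2 * pi * of_int k"
  shows "{a. (a, b, \<mu>) \<in> arnold_tongue k} = closed_segment a0 a\<pi>"
proof -
  define d where "d a x = poincare_lift a b \<mu> x - (x + 2 * pi * of_int k)" for a x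
  have d_cont: "continuous_on A (d a)" for A a
    unfolding d_def
    by (intro continuous_intros continuous_on_subset[OF continuous_on_poincare_lift[OF assms(1)]]) auto
  have d_mono: "d a' x < d a x" if "a' < a" for a a' x
    using poincare_lift_strict_mono_param[OF assms(1) that] by (simp add: d_def)
  have d_mono': "d a' x \<le> d a x" if "a' \<le> a" for a a' x
    using d_mono[of a' a] that by (cases "a' = a") (auto simp: less_imp_le)
  have zero: "d a0 0 = 0" "d a\<pi> pi = 0" using a0 api by (simp_all add: d_def)
  have three: "d a x = 0" if "0 < y" "y < x" "x < z" "z < pi" "d a y = 0" "d a z = 0" for a x y z
    using three_fixed_points[OF assms(1) that(1-4), of a b k] that(5,6) by (simp add: d_def)
  have "(a, b, \<mu>) \<in> arnold_tongue k \<longleftrightarrow> (\<exists>x. d a x = 0)" for a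
    using assms(1) by (auto simp: arnold_tongue_def has_rotation_number_iff_fixed_point d_def)
  moreover have "(\<exists>x. d a x = 0) \<longleftrightarrow> a \<in> closed_segment a0 a\<pi>" for a
  proof
    assume "a \<in> closed_segment a0 a\<pi>"
    then consider "a0 \<le> a" "a \<le> a\<pi>" | "a\<pi> \<le> a" "a \<le> a0"
      by (auto simp: closed_segment_eq_real_ivl split: if_splits)
    then show "\<exists>x. d a x = 0"
    proof cases
      case 1
      then have "d a pi \<le> 0" "0 \<le> d a 0"
        using d_mono'[of a0 a 0] d_mono'[of a a\<pi> pi] zero by simp_all
      then show ?thesis using ivt_between[OF d_cont] by metis
    next
      case 2
      then have "d a 0 \<le> 0" "0 \<le> d a pi"
        using d_mono'[of a a0 0] d_mono'[of a\<pi> a pi] zero by simp_all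
      then show ?thesis using ivt_between[OF d_cont] by metis
    qed
  next
    assume "\<exists>x. d a x = 0"
    then obtain x where x: "0 \<le> x" "x \<le> pi" "d a x = 0"
      using fixed_point_reduce[OF assms(1), of a b _ k] by (auto simp: d_def)
    show "a \<in> closed_segment a0 a\<pi>"
    proof (rule ccontr)
      assume "a \<notin> closed_segment a0 a\<pi>"
      then consider "max a0 a\<pi> < a" | "a < min a0 a\<pi>"
        by (auto simp: closed_segment_eq_real_ivl not_le split: if_splits)
      then show False
      proof cases
        case 1
        then obtain v where v: "max a0 a\<pi> < v" "v < a" using dense by blast
        have ends: "d v 0 > 0" "d v pi > 0" and mid: "d v x < 0"
          using d_mono[of a0 v 0] d_mono[of a\<pi> v pi] d_mono[of v a x] v zero x by simp_all
        obtain y where y: "0 \<le> y" "y \<le> x" "d v y = 0"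
          using IVT2'[of "d v" x 0 0, OF _ _ x(1) d_cont] ends mid by (auto simp: less_imp_le)
        obtain z where z: "x \<le> z" "z \<le> pi" "d v z = 0"
          using IVT'[of "d v" x 0 pi, OF _ _ x(2) d_cont] ends mid by (auto simp: less_imp_le)
        have "0 < y" "y < x" "x < z" "z < pi"
          using y z ends mid by (metis less_irrefl order_le_less)+
        then show False using three[of y x z v] y z mid by simp
      next
        case 2
        then obtain v where v: "a < v" "v < min a0 a\<pi>" using dense by blast
        have ends: "d v 0 < 0" "d v pi < 0" and mid: "d v x > 0"
          using d_mono[of v a0 0] d_mono[of v a\<pi> pi] d_mono[of a v x] v zero x by simp_all
        obtain y where y: "0 \<le> y" "y \<le> x" "d v y = 0"
          using IVT'[of "d v" 0 0 x, OF _ _ x(1) d_cont] ends mid by (auto simp: less_imp_le)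
        obtain z where z: "x \<le> z" "z \<le> pi" "d v z = 0"
          using IVT2'[of "d v" pi 0 x, OF _ _ x(2) d_cont] ends mid by (auto simp: less_imp_le)
        have "0 < y" "y < x" "x < z" "z < pi"
          using y z ends mid by (metis less_irrefl order_le_less)+
        then show False using three[of y x z v] y z mid by simp
      qed
    qed
  qed
  ultimately show ?thesis by blast
qed

lemma tongue_boundary_eq:
  assumes "\<mu> > 0" and \<theta>: "\<theta> = 0 \<or> \<theta> = pi"
    and fp: "poincare_lift a b \<mu> \<theta> = \<theta> + 2 * pi * of_int k"
  shows "tongue_boundary \<theta> b \<mu> k = a"
proof -
  obtain a0 where a0: "poincare_lift a0 b \<mu> 0 = 0 + 2 * pi * of_int k"
    using exists_param_fixing[OF assms(1), of b 0 k] .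
  obtain a\<pi> where a\<pi>: "poincare_lift a\<pi> b \<mu> pi = pi + 2 * pi * of_int k"
    using exists_param_fixing[OF assms(1), of b pi k] .
  have unique: "c = c'" if "poincare_lift c b \<mu> x = y" "poincare_lift c' b \<mu> x = y" for c c' x y
    using poincare_lift_strict_mono_param[OF assms(1), of c c' b x]
      poincare_lift_strict_mono_param[OF assms(1), of c' c b x] that
    by (metis less_irrefl linorder_neqE_linordered_idom)
  note segment = tongue_section_eq_segment[OF assms(1) a0 a\<pi>]
  have "a = a0 \<or> a = a\<pi>" using \<theta> fp a0 a\<pi> unique by blast
  then have "tongue_endpoint b \<mu> k a"
    unfolding tongue_endpoint_def segment by (metis closed_segment_commute)
  moreover have "poincare_fixes a b \<mu> \<theta>" unfolding poincare_fixes_def using fp by blast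
  moreover have "c = a" if c: "tongue_endpoint b \<mu> k c" "poincare_fixes c b \<mu> \<theta>" for c
  proof -
    have "(c, b, \<mu>) \<in> arnold_tongue k"
      using c(1) ends_in_segment(1) unfolding tongue_endpoint_def by blast
    then have "has_rotation_number c b \<mu> (of_int k)" by (simp add: arnold_tongue_def)
    moreover obtain m where m: "poincare_lift c b \<mu> \<theta> = \<theta> + 2 * pi * of_int m"
      using c(2) unfolding poincare_fixes_def by blast
    ultimately have "m = k"
      using rotation_number_unique rotation_number_fixed_point[OF assms(1) m] of_int_eq_iff by metis
    then show ?thesis using unique m fp by metis
  qed
  ultimately show ?thesis unfolding tongue_boundary_def by (intro the_equality conjI) blast+
qed

section \<open>Averaging the fast phase\<close>

locale resonant_phase =
  fixes \<kappa> \<beta> :: real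
  assumes \<beta>_ge_1: "1 \<le> \<beta>" and \<kappa>_le: "\<kappa>\<^sup>2 \<le> \<beta>"
begin

definition freq :: "real \<Rightarrow> real" where
  "freq t = \<kappa> + \<beta> * cos t"

definition recip :: "real \<Rightarrow> real" where
  "recip t = freq t / ((freq t)\<^sup>2 + \<beta>)"

definition recip' :: "real \<Rightarrow> real" where
  "recip' t = - \<beta> * sin t * (\<beta> - (freq t)\<^sup>2) / ((freq t)\<^sup>2 + \<beta>)\<^sup>2"

definition defect :: "real \<Rightarrow> real" where
  "defect t = \<beta> / ((freq t)\<^sup>2 + \<beta>)"

definition weight :: "real \<Rightarrow> real" where
  "weight t = \<beta> * \<bar>sin t\<bar> / ((freq t)\<^sup>2 + \<beta>)"

lemma \<beta>_pos: "0 < \<beta>" using \<beta>_ge_1 by linarith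

lemma den_pos: "0 < (freq t)\<^sup>2 + \<beta>"
  using \<beta>_pos by (simp add: add_nonneg_pos)

lemma den_nz: "(freq t)\<^sup>2 + \<beta> \<noteq> 0"
  using den_pos[of t] by simp

lemma freq_deriv: "(freq has_real_derivative - \<beta> * sin t) (at t)"
  unfolding freq_def by (auto intro!: derivative_eq_intros)

lemma recip_deriv: "(recip has_real_derivative recip' t) (at t)"
  unfolding recip_def
  by (rule derivative_eq_intros refl freq_deriv den_nz)+
    (simp add: recip'_def power2_eq_square algebra_simps)

lemma freq_recip: "freq t * recip t = 1 - defect t"
  using den_nz[of t] by (simp add: recip_def defect_def field_simps power2_eq_square)

lemma continuous_freq: "continuous_on A freq"
  unfolding freq_def by (intro continuous_intros)

lemma continuous_recip: "continuous_on A recip"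
  unfolding recip_def by (intro continuous_intros continuous_freq) (use den_nz in auto)

lemma continuous_recip': "continuous_on A recip'"
  unfolding recip'_def by (intro continuous_intros continuous_freq) (use den_nz in auto)

lemma continuous_defect: "continuous_on A defect"
  unfolding defect_def by (intro continuous_intros continuous_freq) (use den_nz in auto)

lemma continuous_weight: "continuous_on A weight"
  unfolding weight_def by (intro continuous_intros continuous_freq) (use den_nz in auto)

lemmas continuous_kernels =
  continuous_freq continuous_recip continuous_recip' continuous_defect continuous_weight

lemma abs_recip_le: "\<bar>recip t\<bar> \<le> 1 / (2 * sqrt \<beta>)"
proof -
  have "2 * \<bar>freq t\<bar> * sqrt \<beta> \<le> (freq t)\<^sup>2 + \<beta>"
    using sum_squares_bound[of "\<bar>freq t\<bar>" "sqrt \<beta>"] \<beta>_pos by simp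
  then show ?thesis
    using den_pos[of t] \<beta>_pos by (simp add: recip_def abs_divide field_simps)
qed

lemma abs_recip'_le: "\<bar>recip' t\<bar> \<le> weight t"
proof -
  have "\<bar>\<beta> - (freq t)\<^sup>2\<bar> \<le> (freq t)\<^sup>2 + \<beta>"
    using \<beta>_pos by (simp add: abs_le_iff)
  then have "\<bar>\<beta> - (freq t)\<^sup>2\<bar> / ((freq t)\<^sup>2 + \<beta>) \<le> 1"
    using den_pos[of t] by simp
  then have "weight t * (\<bar>\<beta> - (freq t)\<^sup>2\<bar> / ((freq t)\<^sup>2 + \<beta>)) \<le> weight t"
    using \<beta>_pos den_pos[of t] by (intro mult_left_le) (auto simp: weight_def)
  moreover have "\<bar>recip' t\<bar> = weight t * (\<bar>\<beta> - (freq t)\<^sup>2\<bar> / ((freq t)\<^sup>2 + \<beta>))"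
    using \<beta>_pos den_pos[of t]
    by (simp add: recip'_def weight_def abs_divide abs_mult power2_eq_square)
  ultimately show ?thesis by simp
qed

lemma weight_nonneg: "0 \<le> weight t" and defect_nonneg: "0 \<le> defect t"
  using \<beta>_pos den_pos[of t] by (simp_all add: weight_def defect_def)

text \<open>Away from the zeros of \<open>sin\<close> this is \<open>1 \<le> \<bar>sin t\<bar> + cos\<^sup>2 t\<close>; near them \<open>freq\<close> is large.\<close>

lemma defect_le: "defect t \<le> weight t + 2 / \<beta>"
proof -
  have "\<beta>\<^sup>2 * (cos t)\<^sup>2 = (freq t - \<kappa>)\<^sup>2" by (simp add: freq_def power_mult_distrib)
  also have "\<dots> \<le> 2 * (freq t)\<^sup>2 + 2 * \<kappa>\<^sup>2"
    using zero_le_power2[of "freq t + \<kappa>"] by (simp add: power2_eq_square algebra_simps)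
  also have "\<dots> \<le> 2 * ((freq t)\<^sup>2 + \<beta>)" using \<kappa>_le by simp
  finally have cos: "\<beta> * (cos t)\<^sup>2 / ((freq t)\<^sup>2 + \<beta>) \<le> 2 / \<beta>"
    using den_pos[of t] \<beta>_pos by (simp add: field_simps power2_eq_square)
  have "(sin t)\<^sup>2 \<le> \<bar>sin t\<bar>"
    using abs_sin_le_one[of t] by (metis abs_ge_zero mult_left_le power2_abs power2_eq_square)
  then have "1 \<le> \<bar>sin t\<bar> + (cos t)\<^sup>2" using sin_cos_squared_add[of t] by linarith
  then have "\<beta> * 1 \<le> \<beta> * (\<bar>sin t\<bar> + (cos t)\<^sup>2)"
    using \<beta>_pos by (intro mult_left_mono) auto
  then have "defect t \<le> weight t + \<beta> * (cos t)\<^sup>2 / ((freq t)\<^sup>2 + \<beta>)"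
    using den_pos[of t] unfolding defect_def weight_def
    by (simp add: divide_right_mono distrib_left flip: add_divide_distrib)
  with cos show ?thesis by linarith
qed

lemma arctan_freq_deriv:
  "((\<lambda>t. arctan (freq t / sqrt \<beta>) / sqrt \<beta>) has_real_derivative
    - (\<beta> * sin t / ((freq t)\<^sup>2 + \<beta>))) (at t)"
proof -
  have "((\<lambda>t. arctan (freq t / sqrt \<beta>) / sqrt \<beta>) has_real_derivative
      (inverse (1 + (freq t / sqrt \<beta>)\<^sup>2) * (- \<beta> * sin t / sqrt \<beta>)) / sqrt \<beta>) (at t)"
    by (intro DERIV_cdivide DERIV_chain2[OF DERIV_arctan] freq_deriv)
  moreover have "(inverse (1 + (freq t / sqrt \<beta>)\<^sup>2) * (- \<beta> * sin t / sqrt \<beta>)) / sqrt \<beta>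
      = - (\<beta> * sin t / ((freq t)\<^sup>2 + \<beta>))"
  proof -
    have "(freq t / sqrt \<beta>)\<^sup>2 = (freq t)\<^sup>2 / \<beta>" using \<beta>_pos by (simp add: power_divide)
    then have inv: "inverse (1 + (freq t / sqrt \<beta>)\<^sup>2) = \<beta> / ((freq t)\<^sup>2 + \<beta>)"
      using den_nz[of t] \<beta>_pos by (simp add: field_simps)
    have "q * (- \<beta> * s / sqrt \<beta>) / sqrt \<beta> = q * (- \<beta> * s) / \<beta>" for q s
      using \<beta>_pos by simp
    then show ?thesis unfolding inv using \<beta>_pos by (simp only:) simp
  qed
  ultimately show ?thesis by simp
qed

lemma integral_weight_le: "integral {0..2 * pi} weight \<le> 2 * pi / sqrt \<beta>"
proof -
  define A where "A t = arctan (freq t / sqrt \<beta>) / sqrt \<beta>" for t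
  have A: "(A has_real_derivative - (\<beta> * sin t / ((freq t)\<^sup>2 + \<beta>))) (at t)" for t
    unfolding A_def by (rule arctan_freq_deriv)
  have A_diff: "A t - A s \<le> pi / sqrt \<beta>" for s t
  proof -
    have "arctan (freq t / sqrt \<beta>) - arctan (freq s / sqrt \<beta>) \<le> pi"
      using arctan_bounded[of "freq t / sqrt \<beta>"] arctan_bounded[of "freq s / sqrt \<beta>"] by linarith
    then show ?thesis
      using \<beta>_pos unfolding A_def by (simp add: divide_right_mono flip: diff_divide_distrib)
  qed
  have "(weight has_integral (- A pi - - A 0)) {0..pi}"
  proof (rule fundamental_theorem_of_calculus)
    fix t assume "t \<in> {0..pi}"
    then have "0 \<le> sin t" by (simp add: sin_ge_zero)
    then show "((\<lambda>t. - A t) has_vector_derivative weight t) (at t within {0..pi})"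
      using DERIV_minus[OF A[of t]]
      by (simp add: weight_def has_real_derivative_iff_has_vector_derivative has_vector_derivative_at_within)
  qed simp
  moreover have "(weight has_integral (A (2 * pi) - A pi)) {pi..2 * pi}"
  proof (rule fundamental_theorem_of_calculus)
    fix t assume "t \<in> {pi..2 * pi}"
    then have "sin t \<le> 0" by (cases "t = 2 * pi") (auto intro: sin_le_zero)
    then show "(A has_vector_derivative weight t) (at t within {pi..2 * pi})"
      using A[of t]
      by (simp add: weight_def has_real_derivative_iff_has_vector_derivative has_vector_derivative_at_within)
  qed simp
  ultimately have "(weight has_integral ((- A pi - - A 0) + (A (2 * pi) - A pi))) {0..2 * pi}"
    by (rule has_integral_combine[rotated 2]) auto
  then have "integral {0..2 * pi} weight = (A 0 - A pi) + (A (2 * pi) - A pi)"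
    by (simp add: integral_unique)
  then show ?thesis using A_diff[of 0 pi] A_diff[of "2 * pi" pi] by simp
qed

lemma integral_defect_le: "integral {0..2 * pi} defect \<le> 6 * pi / sqrt \<beta>"
proof -
  have "integral {0..2 * pi} defect \<le> integral {0..2 * pi} (\<lambda>t. weight t + 2 / \<beta>)"
    by (intro integral_le integrable_continuous_interval continuous_intros continuous_kernels)
      (rule defect_le)
  also have "\<dots> = integral {0..2 * pi} weight + 4 * pi / \<beta>"
    by (subst integral_add)
      (auto intro!: integrable_continuous_interval continuous_kernels)
  also have "\<dots> \<le> 2 * pi / sqrt \<beta> + 4 * pi / sqrt \<beta>"
  proof (intro add_mono integral_weight_le divide_left_mono)
    show "sqrt \<beta> \<le> \<beta>" using \<beta>_ge_1 real_sqrt_le_mono[of \<beta> "\<beta>\<^sup>2"] by (simp add: power2_eq_square)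
  qed (use \<beta>_pos in auto)
  finally show ?thesis by (simp flip: add_divide_distrib)
qed

lemma integral_bound_by_primitive:
  assumes F: "\<And>t. (F has_real_derivative f t - R t) (at t)"
    and f: "continuous_on UNIV f" and R: "continuous_on UNIV R"
    and le: "\<And>t. t \<in> {0..2 * pi} \<Longrightarrow> \<bar>R t\<bar> \<le> c * (weight t + defect t) + e"
    and "0 \<le> c" "0 \<le> e" "0 \<le> T" "T \<le> 2 * pi"
  shows "\<bar>integral {0..T} f\<bar> \<le> \<bar>F T - F 0\<bar> + c * (8 * pi / sqrt \<beta>) + e * (2 * pi)"
proof -
  have fR: "f integrable_on {0..T}" "R integrable_on {0..T}"
    by (auto intro!: integrable_continuous_interval intro: continuous_on_subset[OF f] continuous_on_subset[OF R])
  have "((\<lambda>t. f t - R t) has_integral (F T - F 0)) {0..T}"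
    by (rule fundamental_theorem_of_calculus[OF \<open>0 \<le> T\<close>])
      (use F in \<open>auto simp: has_real_derivative_iff_has_vector_derivative intro: has_vector_derivative_at_within\<close>)
  then have eq: "integral {0..T} f = (F T - F 0) + integral {0..T} R"
    using integral_diff[OF fR] by (simp add: integral_unique)
  let ?r = "\<lambda>t. c * (weight t + defect t) + e"
  have r: "?r integrable_on {0..U}" for U
    by (intro integrable_continuous_interval continuous_intros continuous_kernels)
  have "\<bar>integral {0..T} R\<bar> \<le> integral {0..T} ?r"
    using integral_norm_bound_integral[OF fR(2) r] le \<open>T \<le> 2 * pi\<close> by auto
  also have "\<dots> \<le> integral {0..2 * pi} ?r"
    by (rule integral_subset_le[OF _ r r])
      (use assms weight_nonneg defect_nonneg in auto)
  also have "\<dots> = c * (integral {0..2 * pi} weight + integral {0..2 * pi} defect) + e * (2 * pi)"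
  proof -
    have "integral {0..2 * pi} (\<lambda>t. weight t + defect t)
        = integral {0..2 * pi} weight + integral {0..2 * pi} defect"
      by (intro integral_add integrable_continuous_interval continuous_kernels)
    then show ?thesis
      by (subst integral_add)
        (auto intro!: integrable_continuous_interval continuous_intros continuous_kernels)
  qed
  also have "\<dots> \<le> c * (2 * pi / sqrt \<beta> + 6 * pi / sqrt \<beta>) + e * (2 * pi)"
    using \<open>0 \<le> c\<close> \<open>0 \<le> e\<close> by (intro add_mono mult_left_mono integral_weight_le integral_defect_le) auto
  finally show ?thesis unfolding eq by (simp flip: add_divide_distrib)
qed

end

lemma integral_odd_cos_eq_0:
  fixes H :: "real \<Rightarrow> real"
  assumes cont: "continuous_on UNIV H" and odd: "\<And>u. H (- u) = - H u"
  shows "integral {0..2 * pi} (\<lambda>t. H (\<beta> * cos t)) = 0"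
proof -
  have "continuous_on UNIV (\<lambda>t. H (\<beta> * cos t))"
    by (intro continuous_on_compose2[OF cont] continuous_intros) auto
  then obtain G where G: "(G has_real_derivative H (\<beta> * cos t)) (at t)" for t
    using real_antiderivative by metis
  have "((\<lambda>t. G (t + pi) + G t) has_real_derivative 0) (at t)" for t
  proof -
    have "((\<lambda>t. G (t + pi) + G t) has_real_derivative H (\<beta> * cos (t + pi)) + H (\<beta> * cos t)) (at t)"
      by (intro DERIV_add G DERIV_shift[THEN iffD1])
    then show ?thesis by (simp add: odd)
  qed
  then have "G (pi + pi) + G pi = G (0 + pi) + G 0"
    using DERIV_isconst_all[of "\<lambda>t. G (t + pi) + G t" pi 0] by simp
  then have "G (2 * pi) - G 0 = 0" by simp
  moreover have "((\<lambda>t. H (\<beta> * cos t)) has_integral (G (2 * pi) - G 0)) {0..2 * pi}"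
    by (rule fundamental_theorem_of_calculus)
      (use G in \<open>auto simp: has_real_derivative_iff_has_vector_derivative intro: has_vector_derivative_at_within\<close>)
  ultimately show ?thesis by (simp add: integral_unique)
qed

context resonant_phase
begin

lemma centred: "resonant_phase 0 \<beta>"
  using \<beta>_ge_1 by unfold_locales auto

interpretation centred: resonant_phase 0 \<beta>
  by (rule centred)

text \<open>The logarithmic divergence of \<open>\<integral> \<bar>1 / freq\<bar>\<close> cancels between the two sides of each zero of
  \<open>freq\<close>: for \<open>\<kappa> = 0\<close> exactly, by oddness, and otherwise up to a perturbation in \<open>\<kappa>\<close>.\<close>

lemma abs_recip_diff_le:
  "\<bar>recip t - centred.recip t\<bar> \<le> \<bar>\<kappa>\<bar> / (2 * \<beta>) * (defect t + centred.defect t)"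
proof -
  let ?u = "freq t" and ?c = "centred.freq t"
  let ?U = "?u\<^sup>2 + \<beta>" and ?C = "?c\<^sup>2 + \<beta>"
  have u: "?u = \<kappa> + ?c" by (simp add: freq_def centred.freq_def)
  have nz: "?U \<noteq> 0" "?C \<noteq> 0" by (rule den_nz centred.den_nz)+
  have pos: "?U > 0" "?C > 0" by (rule den_pos centred.den_pos)+
  have "recip t - centred.recip t = (?u * ?C - ?c * ?U) / (?U * ?C)"
    unfolding recip_def centred.recip_def by (rule diff_frac_eq[OF nz])
  also have "?u * ?C - ?c * ?U = \<kappa> * (\<beta> - ?u * ?c)"
    unfolding u by (simp add: power2_eq_square algebra_simps)
  finally have eq: "\<bar>recip t - centred.recip t\<bar> = \<bar>\<kappa>\<bar> * \<bar>\<beta> - ?u * ?c\<bar> / (?U * ?C)"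
    using pos by (simp add: abs_mult abs_divide)
  have "\<bar>\<beta> - ?u * ?c\<bar> \<le> (?U + ?C) / 2"
    using sum_squares_bound[of ?u ?c] sum_squares_bound[of ?u "- ?c"] \<beta>_pos
    by (intro abs_leI) (simp_all add: field_simps)
  then have "\<bar>\<kappa>\<bar> * \<bar>\<beta> - ?u * ?c\<bar> / (?U * ?C) \<le> \<bar>\<kappa>\<bar> * ((?U + ?C) / 2) / (?U * ?C)"
    using pos by (intro divide_right_mono mult_left_mono) auto
  also have "\<dots> = \<bar>\<kappa>\<bar> / (2 * \<beta>) * (defect t + centred.defect t)"
    unfolding defect_def centred.defect_def using nz \<beta>_pos
    by (simp add: divide_simps) (simp add: algebra_simps)
  finally show ?thesis using eq by simp
qed

lemma abs_integral_recip_le: "\<bar>integral {0..2 * pi} recip\<bar> \<le> 6 * pi / \<beta>"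
proof -
  have "continuous_on UNIV (\<lambda>u. u / (u\<^sup>2 + \<beta>))"
    using \<beta>_pos by (intro continuous_intros ballI) (metis add_nonneg_pos less_irrefl zero_le_power2)
  then have zero: "integral {0..2 * pi} centred.recip = 0"
    using integral_odd_cos_eq_0[of "\<lambda>u. u / (u\<^sup>2 + \<beta>)" \<beta>]
    unfolding centred.recip_def centred.freq_def by simp
  have "\<bar>integral {0..2 * pi} (\<lambda>t. recip t - centred.recip t)\<bar>
      \<le> integral {0..2 * pi} (\<lambda>t. \<bar>\<kappa>\<bar> / (2 * \<beta>) * (defect t + centred.defect t))"
    unfolding real_norm_def[symmetric]
    by (intro integral_norm_bound_integral integrable_continuous_interval continuous_intros
        continuous_kernels centred.continuous_kernels)
      (simp only: real_norm_def abs_recip_diff_le)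
  also have "\<dots> = \<bar>\<kappa>\<bar> / (2 * \<beta>) * (integral {0..2 * pi} defect + integral {0..2 * pi} centred.defect)"
    by (subst integral_mult_right, subst integral_add)
      (auto intro!: integrable_continuous_interval continuous_kernels centred.continuous_kernels)
  also have "\<dots> \<le> sqrt \<beta> / (2 * \<beta>) * (6 * pi / sqrt \<beta> + 6 * pi / sqrt \<beta>)"
  proof (intro mult_mono add_mono integral_defect_le centred.integral_defect_le divide_right_mono)
    show "\<bar>\<kappa>\<bar> \<le> sqrt \<beta>" using real_sqrt_le_mono[OF \<kappa>_le] by simp
    show "0 \<le> integral {0..2 * pi} defect + integral {0..2 * pi} centred.defect"
      by (intro add_nonneg_nonneg integral_nonneg integrable_continuous_interval
          continuous_kernels centred.continuous_kernels defect_nonneg centred.defect_nonneg)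
  qed (use \<beta>_pos in auto)
  also have "\<dots> = 6 * pi / \<beta>" using \<beta>_pos by (simp add: field_simps)
  finally show ?thesis
    using zero
    by (subst (asm) integral_diff)
      (auto intro!: integrable_continuous_interval continuous_kernels centred.continuous_kernels)
qed

lemma abs_integral_cos_double_le:
  assumes x: "\<And>t. (x has_real_derivative v t + freq t) (at t)"
    and v: "continuous_on UNIV v" "\<And>t. \<bar>v t\<bar> \<le> V"
    and periodic: "sin (2 * x (2 * pi)) = sin (2 * x 0)"
  shows "\<bar>integral {0..2 * pi} (\<lambda>t. cos (2 * x t) * recip t)\<bar> \<le> (4 * pi + pi / 2 * V) / \<beta>"
proof -
  have x_cont: "continuous_on A x" for A
    using x by (meson DERIV_continuous continuous_at_imp_continuous_on)
  define F where "F t = sin (2 * x t) / 2 * (recip t)\<^sup>2" for t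
  define R where "R t = cos (2 * x t) * recip t * defect t
    - cos (2 * x t) * v t * (recip t)\<^sup>2 - sin (2 * x t) * recip t * recip' t" for t
  have "0 \<le> V" using v(2)[of 0] by linarith
  have "\<bar>integral {0..2 * pi} (\<lambda>t. cos (2 * x t) * recip t)\<bar>
      \<le> \<bar>F (2 * pi) - F 0\<bar> + 1 / (2 * sqrt \<beta>) * (8 * pi / sqrt \<beta>) + V / (4 * \<beta>) * (2 * pi)"
  proof (rule integral_bound_by_primitive[where R = R])
    fix t
    have "((\<lambda>t. sin (2 * x t) / 2) has_real_derivative cos (2 * x t) * (v t + freq t)) (at t)"
      using x[of t] by (auto intro!: derivative_eq_intros)
    from DERIV_mult[OF this DERIV_power[OF recip_deriv, of 2]]
    have dF: "(F has_real_derivative cos (2 * x t) * (v t + freq t) * (recip t)\<^sup>2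
        + sin (2 * x t) * recip t * recip' t) (at t)"
      unfolding F_def by (simp add: algebra_simps)
    have "cos (2 * x t) * freq t * (recip t)\<^sup>2
        = cos (2 * x t) * recip t * (1 - defect t)"
      unfolding freq_recip[symmetric] by (simp add: power2_eq_square)
    then show "(F has_real_derivative cos (2 * x t) * recip t - R t) (at t)"
      by (intro DERIV_cong[OF dF]) (simp add: R_def algebra_simps)
  next
    fix t
    have "\<bar>R t\<bar> \<le> \<bar>cos (2 * x t) * recip t * defect t\<bar>
        + \<bar>cos (2 * x t) * v t * (recip t)\<^sup>2\<bar> + \<bar>sin (2 * x t) * recip t * recip' t\<bar>"
      unfolding R_def by linarith
    also have "\<dots> = \<bar>cos (2 * x t)\<bar> * \<bar>recip t\<bar> * defect t
        + \<bar>cos (2 * x t)\<bar> * \<bar>v t\<bar> * \<bar>recip t\<bar>\<^sup>2 + \<bar>sin (2 * x t)\<bar> * \<bar>recip t\<bar> * \<bar>recip' t\<bar>"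
      using defect_nonneg[of t] by (simp add: abs_mult)
    also have "\<dots> \<le> 1 * (1 / (2 * sqrt \<beta>)) * defect t + 1 * V * (1 / (2 * sqrt \<beta>))\<^sup>2
        + 1 * (1 / (2 * sqrt \<beta>)) * weight t"
      using defect_nonneg[of t] weight_nonneg[of t] \<open>0 \<le> V\<close> v(2)[of t] \<beta>_pos
      by (intro add_mono mult_mono power_mono abs_recip_le abs_recip'_le) auto
    also have "\<dots> = 1 / (2 * sqrt \<beta>) * (weight t + defect t) + V / (4 * \<beta>)"
      using \<beta>_pos by (simp add: power_mult_distrib power_divide distrib_left add_divide_distrib)
    finally show "\<bar>R t\<bar> \<le> 1 / (2 * sqrt \<beta>) * (weight t + defect t) + V / (4 * \<beta>)" .
  qed (use \<open>0 \<le> V\<close> \<beta>_pos in \<open>auto simp: R_def intro!: continuous_intros continuous_kernels x_cont v\<close>)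
  also have "F (2 * pi) - F 0 = 0"
    unfolding F_def periodic by (simp add: recip_def freq_def)
  also have "\<bar>0\<bar> + 1 / (2 * sqrt \<beta>) * (8 * pi / sqrt \<beta>) + V / (4 * \<beta>) * (2 * pi)
      = (4 * pi + pi / 2 * V) / \<beta>"
    using \<beta>_pos by (simp add: field_simps)
  finally show ?thesis .
qed

lemma abs_integral_cos_le:
  assumes x: "\<And>t. (x has_real_derivative v t + freq t) (at t)"
    and v: "continuous_on UNIV v" "\<And>t. \<bar>v t\<bar> \<le> V"
    and T: "0 \<le> T" "T \<le> 2 * pi"
  shows "\<bar>integral {0..T} (\<lambda>t. cos (x t))\<bar> \<le> (1 + 8 * pi + pi * V) / sqrt \<beta>"
proof -
  have x_cont: "continuous_on A x" for A
    using x by (meson DERIV_continuous continuous_at_imp_continuous_on)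
  define F where "F t = sin (x t) * recip t" for t
  define R where "R t = cos (x t) * defect t - cos (x t) * v t * recip t - sin (x t) * recip' t" for t
  have "0 \<le> V" using v(2)[of 0] by linarith
  have "\<bar>integral {0..T} (\<lambda>t. cos (x t))\<bar>
      \<le> \<bar>F T - F 0\<bar> + 1 * (8 * pi / sqrt \<beta>) + V / (2 * sqrt \<beta>) * (2 * pi)"
  proof (rule integral_bound_by_primitive[where R = R])
    fix t
    have "((\<lambda>t. sin (x t)) has_real_derivative cos (x t) * (v t + freq t)) (at t)"
      using x[of t] by (auto intro!: derivative_eq_intros)
    from DERIV_mult[OF this recip_deriv]
    have dF: "(F has_real_derivative cos (x t) * (v t + freq t) * recip t + sin (x t) * recip' t) (at t)"
      unfolding F_def by (simp add: algebra_simps)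
    have "cos (x t) * freq t * recip t = cos (x t) * (1 - defect t)"
      unfolding freq_recip[symmetric] by simp
    then show "(F has_real_derivative cos (x t) - R t) (at t)"
      by (intro DERIV_cong[OF dF]) (simp add: R_def algebra_simps)
  next
    fix t
    have "\<bar>R t\<bar> \<le> \<bar>cos (x t) * defect t\<bar> + \<bar>cos (x t) * v t * recip t\<bar> + \<bar>sin (x t) * recip' t\<bar>"
      unfolding R_def by linarith
    also have "\<dots> = \<bar>cos (x t)\<bar> * defect t + \<bar>cos (x t)\<bar> * \<bar>v t\<bar> * \<bar>recip t\<bar> + \<bar>sin (x t)\<bar> * \<bar>recip' t\<bar>"
      using defect_nonneg[of t] by (simp add: abs_mult)
    also have "\<dots> \<le> 1 * defect t + 1 * V * (1 / (2 * sqrt \<beta>)) + 1 * weight t"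
      using defect_nonneg[of t] weight_nonneg[of t] \<open>0 \<le> V\<close> v(2)[of t] \<beta>_pos
      by (intro add_mono mult_mono abs_recip_le abs_recip'_le) auto
    finally show "\<bar>R t\<bar> \<le> 1 * (weight t + defect t) + V / (2 * sqrt \<beta>)" by simp
  qed (use \<open>0 \<le> V\<close> \<beta>_pos T in \<open>auto simp: R_def intro!: continuous_intros continuous_kernels x_cont v\<close>)
  moreover have "\<bar>F T - F 0\<bar> \<le> 1 / sqrt \<beta>"
  proof -
    have "\<bar>F t\<bar> \<le> 1 * (1 / (2 * sqrt \<beta>))" for t
      unfolding F_def abs_mult by (intro mult_mono abs_recip_le) auto
    from this[of T] this[of 0] have "\<bar>F T - F 0\<bar> \<le> 2 * (1 / (2 * sqrt \<beta>))" by linarith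
    then show ?thesis by simp
  qed
  moreover have "1 / sqrt \<beta> + 1 * (8 * pi / sqrt \<beta>) + V / (2 * sqrt \<beta>) * (2 * pi)
      = (1 + 8 * pi + pi * V) / sqrt \<beta>"
    by (simp add: add_divide_distrib)
  ultimately show ?thesis by linarith
qed

text \<open>Since \<open>x\<close> stays close to the phase \<open>\<phi>\<close> of the unperturbed equation, integration by parts
  against \<open>recip\<close> gains a second factor \<open>1 / sqrt \<beta>\<close>.\<close>

lemma detuning_estimate:
  fixes x :: "real \<Rightarrow> real" and k :: int
  assumes x: "\<And>t. (x has_real_derivative \<omega> * cos (x t) + \<delta> + freq t) (at t)"
    and "0 < \<omega>" and \<kappa>: "\<kappa> = of_int k" and \<theta>: "sin \<theta> = 0"
    and ends: "x 0 = \<theta>" "x (2 * pi) = \<theta> + 2 * pi * of_int k"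
  shows "\<bar>\<delta> + \<omega> * (cos \<theta> * bessel_J k (- \<beta>))\<bar> \<le> 2200 * (\<omega> / \<beta>) * (1 + \<omega> ^ 3)"
proof -
  define \<phi> where "\<phi> t = \<theta> + \<kappa> * t + \<beta> * sin t" for t
  define v where "v t = \<omega> * cos (x t) + \<delta>" for t
  define Q where "Q = (1 + 8 * pi + pi * (2 * \<omega>)) / sqrt \<beta>"
  have x_cont: "continuous_on A x" for A
    using x by (meson DERIV_continuous continuous_at_imp_continuous_on)
  have \<phi>_cont: "continuous_on A \<phi>" for A
    unfolding \<phi>_def by (intro continuous_intros)
  have v_cont: "continuous_on A v" for A
    unfolding v_def by (intro continuous_intros x_cont)
  have dx: "(x has_real_derivative v t + freq t) (at t)" for t
    using x by (simp add: v_def)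
  have d\<phi>: "(\<phi> has_real_derivative freq t) (at t)" for t
    unfolding \<phi>_def freq_def by (auto intro!: derivative_eq_intros)
  have dev: "x T - \<phi> T = \<omega> * integral {0..T} (\<lambda>t. cos (x t)) + \<delta> * T" if "0 \<le> T" for T
  proof -
    have "((\<lambda>t. x t - \<phi> t) has_real_derivative v t) (at t)" for t
      using DERIV_diff[OF dx[of t] d\<phi>[of t]] by simp
    then have "(v has_integral ((x T - \<phi> T) - (x 0 - \<phi> 0))) {0..T}"
      by (intro fundamental_theorem_of_calculus[OF that])
        (auto simp: has_real_derivative_iff_has_vector_derivative intro: has_vector_derivative_at_within)
    then have "x T - \<phi> T = integral {0..T} v"
      by (simp add: integral_unique ends \<phi>_def)
    also have "\<dots> = \<omega> * integral {0..T} (\<lambda>t. cos (x t)) + \<delta> * T"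
      unfolding v_def using that
      by (subst integral_add)
        (auto intro!: integrable_continuous_interval continuous_intros x_cont)
    finally show ?thesis .
  qed
  have "x (2 * pi) = \<phi> (2 * pi)" by (simp add: ends \<phi>_def \<kappa>)
  then have \<delta>: "\<delta> * (2 * pi) = - (\<omega> * integral {0..2 * pi} (\<lambda>t. cos (x t)))"
    using dev[of "2 * pi"] by simp
  have \<delta>_\<omega>: "\<bar>\<delta>\<bar> \<le> \<omega>"
  proof -
    have "norm (integral {0..2 * pi} (\<lambda>t. cos (x t))) \<le> 1 * (2 * pi - 0)"
      by (rule integral_bound) (auto intro!: continuous_intros x_cont)
    then have "\<omega> * \<bar>integral {0..2 * pi} (\<lambda>t. cos (x t))\<bar> \<le> \<omega> * (2 * pi)"
      using \<open>0 < \<omega>\<close> by simp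
    then have "\<bar>\<delta> * (2 * pi)\<bar> \<le> \<omega> * (2 * pi)"
      using \<open>0 < \<omega>\<close> unfolding \<delta> by (simp add: abs_mult)
    then show ?thesis by (simp add: abs_mult)
  qed
  have v_le: "\<bar>v t\<bar> \<le> 2 * \<omega>" for t
  proof -
    have "\<bar>v t\<bar> \<le> \<bar>\<omega> * cos (x t)\<bar> + \<bar>\<delta>\<bar>" unfolding v_def by (rule abs_triangle_ineq)
    moreover have "\<bar>\<omega> * cos (x t)\<bar> \<le> \<omega>" using \<open>0 < \<omega>\<close> by (simp add: abs_mult)
    ultimately show ?thesis using \<delta>_\<omega> by linarith
  qed
  have cos_le: "\<bar>integral {0..T} (\<lambda>t. cos (x t))\<bar> \<le> Q" if "0 \<le> T" "T \<le> 2 * pi" for T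
    unfolding Q_def by (rule abs_integral_cos_le[OF dx v_cont v_le that])
  have "0 \<le> Q" using cos_le[of 0] by simp
  have \<delta>_Q: "\<bar>\<delta>\<bar> * (2 * pi) \<le> \<omega> * Q"
  proof -
    have "\<bar>\<delta> * (2 * pi)\<bar> \<le> \<omega> * Q"
      using cos_le[of "2 * pi"] \<open>0 < \<omega>\<close> unfolding \<delta> by (simp add: abs_mult)
    then show ?thesis by (simp add: abs_mult)
  qed
  have close: "\<bar>x T - \<phi> T\<bar> \<le> 2 * \<omega> * Q" if "0 \<le> T" "T \<le> 2 * pi" for T
  proof -
    have "\<bar>\<delta> * T\<bar> \<le> \<omega> * Q"
      using \<delta>_Q mult_left_mono[OF that(2), of "\<bar>\<delta>\<bar>"] that(1) by (simp add: abs_mult)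
    moreover have "\<bar>\<omega> * integral {0..T} (\<lambda>t. cos (x t))\<bar> \<le> \<omega> * Q"
      using cos_le[OF that] \<open>0 < \<omega>\<close> by (simp add: abs_mult)
    ultimately show ?thesis unfolding dev[OF that(1)] by linarith
  qed

  define F where "F t = (sin (x t) - sin (\<phi> t)) * recip t" for t
  define R where "R t = (cos (x t) - cos (\<phi> t)) * defect t - \<delta> * (cos (x t) * recip t)
    - (sin (x t) - sin (\<phi> t)) * recip' t" for t
  define f where "f t = cos (x t) - cos (\<phi> t) + \<omega> * ((cos (x t))\<^sup>2 * recip t)" for t
  have "\<bar>integral {0..2 * pi} f\<bar>
      \<le> \<bar>F (2 * pi) - F 0\<bar> + 2 * \<omega> * Q * (8 * pi / sqrt \<beta>) + \<bar>\<delta>\<bar> * (1 / (2 * sqrt \<beta>)) * (2 * pi)"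
  proof (rule integral_bound_by_primitive[where R = R])
    fix t
    have "((\<lambda>t. sin (x t) - sin (\<phi> t)) has_real_derivative
        cos (x t) * (v t + freq t) - cos (\<phi> t) * freq t) (at t)"
      using dx[of t] d\<phi>[of t] by (auto intro!: derivative_eq_intros)
    from DERIV_mult[OF this recip_deriv]
    have "(F has_real_derivative (cos (x t) - cos (\<phi> t)) * (freq t * recip t)
        + cos (x t) * v t * recip t + (sin (x t) - sin (\<phi> t)) * recip' t) (at t)"
      unfolding F_def by (simp add: algebra_simps)
    then show "(F has_real_derivative f t - R t) (at t)"
      unfolding freq_recip f_def R_def v_def by (simp add: algebra_simps power2_eq_square)
  next
    fix t assume t: "t \<in> {0..2 * pi}"
    have near: "\<bar>cos (x t) - cos (\<phi> t)\<bar> \<le> 2 * \<omega> * Q" "\<bar>sin (x t) - sin (\<phi> t)\<bar> \<le> 2 * \<omega> * Q"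
      using close[of t] t abs_cos_diff_le[of "x t" "\<phi> t"] abs_sin_diff_le[of "x t" "\<phi> t"] by auto
    have "\<bar>R t\<bar> \<le> \<bar>(cos (x t) - cos (\<phi> t)) * defect t\<bar> + \<bar>\<delta> * (cos (x t) * recip t)\<bar>
        + \<bar>(sin (x t) - sin (\<phi> t)) * recip' t\<bar>"
      unfolding R_def by linarith
    also have "\<dots> = \<bar>cos (x t) - cos (\<phi> t)\<bar> * defect t + \<bar>\<delta>\<bar> * (\<bar>cos (x t)\<bar> * \<bar>recip t\<bar>)
        + \<bar>sin (x t) - sin (\<phi> t)\<bar> * \<bar>recip' t\<bar>"
      using defect_nonneg[of t] by (simp add: abs_mult)
    also have "\<dots> \<le> 2 * \<omega> * Q * defect t + \<bar>\<delta>\<bar> * (1 * (1 / (2 * sqrt \<beta>)))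
        + 2 * \<omega> * Q * weight t"
      using near defect_nonneg[of t] weight_nonneg[of t] \<open>0 < \<omega>\<close> \<open>0 \<le> Q\<close>
      by (intro add_mono mult_mono abs_recip_le abs_recip'_le) auto
    finally show "\<bar>R t\<bar> \<le> 2 * \<omega> * Q * (weight t + defect t) + \<bar>\<delta>\<bar> * (1 / (2 * sqrt \<beta>))"
      by (simp add: algebra_simps)
  qed (use \<open>0 < \<omega>\<close> \<open>0 \<le> Q\<close> \<beta>_pos in
      \<open>auto simp: R_def f_def intro!: continuous_intros continuous_kernels x_cont \<phi>_cont\<close>)
  also have "F (2 * pi) - F 0 = 0"
    using \<open>x (2 * pi) = \<phi> (2 * pi)\<close> by (simp add: F_def \<phi>_def ends mult.commute)
  also have "\<bar>0\<bar> + 2 * \<omega> * Q * (8 * pi / sqrt \<beta>) + \<bar>\<delta>\<bar> * (1 / (2 * sqrt \<beta>)) * (2 * pi)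
      = (16 * pi * (\<omega> * Q) + \<bar>\<delta>\<bar> * (2 * pi) / 2) / sqrt \<beta>"
    by (simp add: add_divide_distrib)
  also have "\<dots> \<le> (64 * (\<omega> * Q) + \<omega> * Q) / sqrt \<beta>"
  proof (rule divide_right_mono)
    have "16 * pi * (\<omega> * Q) \<le> 64 * (\<omega> * Q)"
      using pi_less_4 \<open>0 < \<omega>\<close> \<open>0 \<le> Q\<close> by (intro mult_right_mono) auto
    moreover have "\<bar>\<delta>\<bar> * (2 * pi) / 2 \<le> \<omega> * Q"
      using \<delta>_Q \<open>0 < \<omega>\<close> \<open>0 \<le> Q\<close> mult_nonneg_nonneg[of \<omega> Q] by linarith
    ultimately show "16 * pi * (\<omega> * Q) + \<bar>\<delta>\<bar> * (2 * pi) / 2 \<le> 64 * (\<omega> * Q) + \<omega> * Q" by linarith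
  qed (use \<beta>_pos in auto)
  also have "\<dots> = 65 * \<omega> * (1 + 8 * pi + pi * (2 * \<omega>)) / \<beta>"
  proof -
    have "(64 * (\<omega> * Q) + \<omega> * Q) / sqrt \<beta>
        = 65 * \<omega> * (1 + 8 * pi + pi * (2 * \<omega>)) / (sqrt \<beta> * sqrt \<beta>)"
      by (simp add: Q_def)
    then show ?thesis using \<beta>_pos by simp
  qed
  also have "\<dots> \<le> 65 * \<omega> * (33 * (1 + \<omega>)) / \<beta>"
  proof -
    have "1 + 8 * pi + pi * (2 * \<omega>) \<le> 1 + 8 * 4 + 4 * (2 * \<omega>)"
      using pi_less_4 \<open>0 < \<omega>\<close> by (intro add_mono mult_left_mono mult_right_mono) auto
    also have "\<dots> \<le> 33 * (1 + \<omega>)" using \<open>0 < \<omega>\<close> by simp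
    finally have "1 + 8 * pi + pi * (2 * \<omega>) \<le> 33 * (1 + \<omega>)" .
    then show ?thesis using \<open>0 < \<omega>\<close> \<beta>_pos by (intro divide_right_mono mult_left_mono) auto
  qed
  also have "\<dots> = 2145 * (\<omega> * (1 + \<omega>) / \<beta>)" by (simp add: algebra_simps)
  finally have f_le: "\<bar>integral {0..2 * pi} f\<bar> \<le> 2145 * (\<omega> * (1 + \<omega>) / \<beta>)" .

  have sq_le: "\<bar>integral {0..2 * pi} (\<lambda>t. (cos (x t))\<^sup>2 * recip t)\<bar> \<le> 20 * ((1 + \<omega>) / \<beta>)"
  proof -
    let ?D = "integral {0..2 * pi} (\<lambda>t. cos (2 * x t) * recip t)"
    have "sin (2 * x (2 * pi)) = sin (2 * x 0)"
      unfolding sin_double ends by (simp add: sin_add cos_add)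
    from abs_integral_cos_double_le[OF dx v_cont v_le this]
    have D: "\<bar>?D\<bar> \<le> (4 * pi + pi * \<omega>) / \<beta>" by simp
    have "(cos (x t))\<^sup>2 * recip t = (1 / 2) * (recip t + cos (2 * x t) * recip t)" for t
      unfolding cos_double_cos by (simp add: algebra_simps)
    then have "integral {0..2 * pi} (\<lambda>t. (cos (x t))\<^sup>2 * recip t)
        = integral {0..2 * pi} (\<lambda>t. (1 / 2) * (recip t + cos (2 * x t) * recip t))"
      by (simp only:)
    also have "\<dots> = (1 / 2) * (integral {0..2 * pi} recip + ?D)"
      by (subst integral_mult_right, subst integral_add)
        (auto intro!: integrable_continuous_interval continuous_intros continuous_kernels x_cont)
    finally have "\<bar>integral {0..2 * pi} (\<lambda>t. (cos (x t))\<^sup>2 * recip t)\<bar>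
        \<le> (\<bar>integral {0..2 * pi} recip\<bar> + \<bar>?D\<bar>) / 2"
      by (simp add: abs_triangle_ineq)
    also have "\<dots> \<le> (6 * pi / \<beta> + (4 * pi + pi * \<omega>) / \<beta>) / 2"
      by (intro divide_right_mono add_mono abs_integral_recip_le D) simp
    also have "\<dots> = (5 * pi + pi * \<omega> / 2) / \<beta>"
      by (simp add: add_divide_distrib)
    also have "\<dots> \<le> 20 * (1 + \<omega>) / \<beta>"
    proof (rule divide_right_mono)
      have "5 * pi + pi * \<omega> / 2 \<le> 5 * 4 + 4 * \<omega> / 2"
        using pi_less_4 \<open>0 < \<omega>\<close> by (intro add_mono divide_right_mono mult_left_mono mult_right_mono) auto
      also have "\<dots> \<le> 20 * (1 + \<omega>)" using \<open>0 < \<omega>\<close> by simp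
      finally show "5 * pi + pi * \<omega> / 2 \<le> 20 * (1 + \<omega>)" .
    qed (use \<beta>_pos in auto)
    finally show ?thesis by simp
  qed

  let ?X = "integral {0..2 * pi} (\<lambda>t. cos (x t))" and ?\<Phi> = "integral {0..2 * pi} (\<lambda>t. cos (\<phi> t))"
  have "integral {0..2 * pi} f = ?X - ?\<Phi> + \<omega> * integral {0..2 * pi} (\<lambda>t. (cos (x t))\<^sup>2 * recip t)"
    unfolding f_def
    by (subst integral_add, (intro integrable_continuous_interval continuous_intros continuous_kernels x_cont \<phi>_cont)+,
        subst integral_diff, (intro integrable_continuous_interval continuous_intros x_cont \<phi>_cont)+) simp
  moreover have "\<bar>\<omega> * integral {0..2 * pi} (\<lambda>t. (cos (x t))\<^sup>2 * recip t)\<bar> \<le> \<omega> * (20 * ((1 + \<omega>) / \<beta>))"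
    unfolding abs_mult using sq_le \<open>0 < \<omega>\<close> by (intro mult_mono) auto
  ultimately have "\<bar>?X - ?\<Phi>\<bar> \<le> 2145 * (\<omega> * (1 + \<omega>) / \<beta>) + \<omega> * (20 * ((1 + \<omega>) / \<beta>))"
    using f_le by linarith
  moreover have "\<omega> * (20 * ((1 + \<omega>) / \<beta>)) = 20 * (\<omega> * (1 + \<omega>) / \<beta>)"
    by (simp only: times_divide_eq_right mult.left_commute)
  moreover have "0 \<le> \<omega> * (1 + \<omega>) / \<beta>" using \<open>0 < \<omega>\<close> \<beta>_pos by simp
  ultimately have diff: "\<bar>?X - ?\<Phi>\<bar> \<le> 2200 * (\<omega> * (1 + \<omega>) / \<beta>)"
    by linarith

  have "cos (\<phi> t) = cos \<theta> * cos (of_int k * t - (- \<beta>) * sin t)" for t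
    using \<theta> by (simp add: \<phi>_def \<kappa> cos_add add.assoc)
  then have \<Phi>: "?\<Phi> = 2 * pi * (cos \<theta> * bessel_J k (- \<beta>))"
    by (simp add: bessel_J_def)
  have "(2 * pi) * (\<delta> + \<omega> * (cos \<theta> * bessel_J k (- \<beta>))) = - (\<omega> * (?X - ?\<Phi>))"
    using \<delta> unfolding \<Phi> by (simp add: algebra_simps)
  then have "\<bar>(2 * pi) * (\<delta> + \<omega> * (cos \<theta> * bessel_J k (- \<beta>)))\<bar> = \<bar>\<omega> * (?X - ?\<Phi>)\<bar>"
    by (simp only: abs_minus_cancel)
  then have "(2 * pi) * \<bar>\<delta> + \<omega> * (cos \<theta> * bessel_J k (- \<beta>))\<bar> = \<omega> * \<bar>?X - ?\<Phi>\<bar>"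
    unfolding abs_mult using \<open>0 < \<omega>\<close> by simp
  also have "\<dots> \<le> \<omega> * (2200 * (\<omega> * (1 + \<omega>) / \<beta>))"
    using diff \<open>0 < \<omega>\<close> by (intro mult_left_mono) auto
  also have "\<dots> = 2200 * (\<omega> / \<beta>) * (\<omega> + \<omega>\<^sup>2)"
    by (simp add: power2_eq_square algebra_simps)
  also have "\<dots> \<le> 2200 * (\<omega> / \<beta>) * (2 * (1 + \<omega> ^ 3))"
  proof (rule mult_left_mono)
    have "\<omega> \<le> 1 + \<omega> ^ 3 \<and> \<omega>\<^sup>2 \<le> 1 + \<omega> ^ 3"
    proof (cases "\<omega> \<le> 1")
      case True
      then show ?thesis using \<open>0 < \<omega>\<close> power_le_one[of \<omega> 2] zero_le_power[of \<omega> 3] by linarith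
    next
      case False
      then have "\<omega> ^ 1 \<le> \<omega> ^ 3" "\<omega> ^ 2 \<le> \<omega> ^ 3" by (intro power_increasing; simp)+
      then show ?thesis unfolding power_one_right by linarith
    qed
    then show "\<omega> + \<omega>\<^sup>2 \<le> 2 * (1 + \<omega> ^ 3)" by (simp add: distrib_left)
  qed (use \<open>0 < \<omega>\<close> \<beta>_pos in auto)
  finally have "(2 * pi) * \<bar>\<delta> + \<omega> * (cos \<theta> * bessel_J k (- \<beta>))\<bar>
      \<le> 2 * (2200 * (\<omega> / \<beta>) * (1 + \<omega> ^ 3))"
    by (simp only: mult.left_commute[of _ 2])
  moreover have "2 * \<bar>\<delta> + \<omega> * (cos \<theta> * bessel_J k (- \<beta>))\<bar>
      \<le> (2 * pi) * \<bar>\<delta> + \<omega> * (cos \<theta> * bessel_J k (- \<beta>))\<bar>"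
    using pi_ge_two by (intro mult_right_mono) auto
  ultimately have "2 * \<bar>\<delta> + \<omega> * (cos \<theta> * bessel_J k (- \<beta>))\<bar>
      \<le> 2 * (2200 * (\<omega> / \<beta>) * (1 + \<omega> ^ 3))"
    by (rule order_trans[rotated])
  then show ?thesis by (simp only: mult_le_cancel_left_pos zero_less_numeral)
qed

end

lemma tongue_boundary_estimate:
  assumes "\<mu> > 0" and \<theta>: "\<theta> = 0 \<or> \<theta> = pi"
    and k: "\<bar>of_int k * \<mu>\<bar> \<le> sqrt (b * \<mu>)" and b: "\<mu> \<le> b"
  shows "\<bar>tongue_boundary \<theta> b \<mu> k / \<mu> - of_int k + 1 / \<mu> * (cos \<theta> * bessel_J k (- b / \<mu>))\<bar>
    \<le> 1 / b * (2200 + 2200 / \<mu> ^ 3 + ln (b / \<mu>))"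
proof -
  interpret resonant_phase "of_int k" "b / \<mu>"
  proof
    show "1 \<le> b / \<mu>" using assms by simp
    have "(\<bar>of_int k * \<mu>\<bar>)\<^sup>2 \<le> (sqrt (b * \<mu>))\<^sup>2" by (rule power_mono[OF k]) simp
    then have "(of_int k)\<^sup>2 * \<mu> * \<mu> \<le> b * \<mu>"
      using assms by (simp add: power_mult_distrib power2_eq_square mult.assoc)
    then have "(of_int k)\<^sup>2 * \<mu> \<le> b" using \<open>\<mu> > 0\<close> by simp
    then show "(of_int k)\<^sup>2 \<le> b / \<mu>" using \<open>\<mu> > 0\<close> by (simp add: pos_le_divide_eq)
  qed
  obtain a where a: "poincare_lift a b \<mu> \<theta> = \<theta> + 2 * pi * of_int k"
    using exists_param_fixing[OF \<open>\<mu> > 0\<close>] .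
  obtain x where x: "josephson_solution a b \<mu> x" "x 0 = \<theta>" "x (2 * pi) = poincare_lift a b \<mu> \<theta>"
    using poincare_lift_solution[OF \<open>\<mu> > 0\<close>] .
  have "(x has_real_derivative 1 / \<mu> * cos (x t) + (a / \<mu> - of_int k) + freq t) (at t)" for t
  proof -
    have "1 / \<mu> * cos (x t) + (a / \<mu> - of_int k) + freq t = (cos (x t) + a + b * cos t) / \<mu>"
      by (simp add: freq_def add_divide_distrib)
    then show ?thesis using x(1) unfolding josephson_solution_def by simp
  qed
  moreover have "x (2 * pi) = \<theta> + 2 * pi * of_int k" using x(3) a by simp
  moreover have "sin \<theta> = 0" using \<theta> by auto
  ultimately have "\<bar>(a / \<mu> - of_int k) + 1 / \<mu> * (cos \<theta> * bessel_J k (- (b / \<mu>)))\<bar>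
      \<le> 2200 * ((1 / \<mu>) / (b / \<mu>)) * (1 + (1 / \<mu>) ^ 3)"
    using x(2) \<open>\<mu> > 0\<close>
    by (intro detuning_estimate[where x = x and \<theta> = \<theta> and k = k and \<omega> = "1 / \<mu>"
          and \<delta> = "a / \<mu> - of_int k"]) auto
  also have "\<dots> = 1 / b * (2200 + 2200 / \<mu> ^ 3)"
    using \<open>\<mu> > 0\<close> by (simp add: power_one_over distrib_left add_divide_distrib)
  also have "\<dots> \<le> 1 / b * (2200 + 2200 / \<mu> ^ 3 + ln (b / \<mu>))"
    using assms by (intro mult_left_mono) auto
  finally show ?thesis
    using tongue_boundary_eq[OF \<open>\<mu> > 0\<close> \<theta> a] by simp
qed

theorem theorem2:
  shows "\<exists>C1 C2 K1 K2 K3 :: real.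
    C1 > 0 \<and> C2 > 0 \<and> K1 > 0 \<and> K2 > 0 \<and> K3 > 0 \<and>
    (\<forall>(b::real) (\<mu>::real) (k::int).
       \<mu> > 0 \<longrightarrow>
       \<bar>of_int k * \<mu>\<bar> + 1 \<le> C1 * sqrt (b * \<mu>) \<longrightarrow>
       b \<ge> C2 * \<mu> \<longrightarrow>
         \<bar>tongue_boundary_0 b \<mu> k / \<mu> - of_int k + 1 / \<mu> * bessel_J k (- b / \<mu>)\<bar>
           \<le> 1 / b * (K1 + K2 / \<mu> ^ 3 + K3 * ln (b / \<mu>)) \<and>
         \<bar>tongue_boundary_pi b \<mu> k / \<mu> - of_int k - 1 / \<mu> * bessel_J k (- b / \<mu>)\<bar>
           \<le> 1 / b * (K1 + K2 / \<mu> ^ 3 + K3 * ln (b / \<mu>)))"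
proof (rule exI[of _ 1], rule exI[of _ 1], rule exI[of _ 2200], rule exI[of _ 2200], rule exI[of _ 1],
    intro conjI allI impI)
  fix b \<mu> :: real and k :: int
  assume "\<mu> > 0" "\<bar>of_int k * \<mu>\<bar> + 1 \<le> 1 * sqrt (b * \<mu>)" "b \<ge> 1 * \<mu>"
  then have "\<bar>of_int k * \<mu>\<bar> \<le> sqrt (b * \<mu>)" "\<mu> \<le> b" by simp_all
  from tongue_boundary_estimate[OF \<open>\<mu> > 0\<close> _ this]
  show "\<bar>tongue_boundary_0 b \<mu> k / \<mu> - of_int k + 1 / \<mu> * bessel_J k (- b / \<mu>)\<bar>
      \<le> 1 / b * (2200 + 2200 / \<mu> ^ 3 + 1 * ln (b / \<mu>))"
    "\<bar>tongue_boundary_pi b \<mu> k / \<mu> - of_int k - 1 / \<mu> * bessel_J k (- b / \<mu>)\<bar>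
      \<le> 1 / b * (2200 + 2200 / \<mu> ^ 3 + 1 * ln (b / \<mu>))"
    by force+
qed simp_all

end
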